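(* Let $\mathcal{I}_1$ and $\mathcal{I}_2$ be operator ideals such that either $\mathcal{I}_2\subseteq \mathcal{I}_1^{dual}$ or $\mathcal{I}_2^{dual}\subseteq \mathcal{I}_1$, and let $E$ be a reflexive Banach space. (a) If $E'$ has the $\mathcal{I}_2$-approximation property, then $E$ has the $\mathcal{I}_1$-approximation property. (b) If $E$ has the $\mathcal{I}_2$-approximation property, then $E'$ has the $\mathcal{I}_1$-approximation property.
   Context: Banach spaces are over $\mathbb{K}=\mathbb{R}$ or $\mathbb{C}$; $\mathcal{L}(E;F)$ is the Banach space of bounded linear operators from $E$ to $F$ and $E'=\mathcal{L}(E;\mathbb{K})$. An operator ideal $\mathcal{I}$ is a subclass of the class of all continuous linear operators between Banach spaces such that for all Banach spaces $E,F$ the component $\mathcal{I}(E;F)=\mathcal{L}(E;F)\cap\mathcal{I}$ is a linear subspace of $\mathcal{L}(E;F)$ containing the finite rank operators, and $S\circ R\circ T\in\mathcal{I}(E;H)$ whenever $T\in\mathcal{L}(E;F)$, $R\in\mathcal{I}(F;G)$, $S\in\mathcal{L}(G;H)$. The symbol $\overline{S}^{\tau_c}$ denotes the closure in the compact-open topology $\tau_c$ (uniform convergence on compact sets). A Banach space $E$ has the $\mathcal{I}$-approximation property if $\mathcal{L}(E;E)=\overline{\mathcal{I}(E;E)}^{\tau_c}$. The dual ideal $\mathcal{I}^{dual}$ is the operator ideal with components $\mathcal{I}^{dual}(E;F)=\{S\in\mathcal{L}(E;F): S'\in\mathcal{I}(F';E')\}$, where $S'$ is the adjoint of $S$. *)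

theory Defs
  imports "HOL-Analysis.Analysis"
begin

text \<open>
  The scalar field is the real or the complex numbers: a normed field that is isometrically
  isomorphic to one of the two.
\<close>

class real_or_complex = real_normed_field +
  assumes real_or_complex:
    "\<exists>\<phi> :: 'a \<Rightarrow> complex.
       (\<forall>x y. \<phi> (x + y) = \<phi> x + \<phi> y) \<and> (\<forall>x y. \<phi> (x * y) = \<phi> x * \<phi> y) \<and> \<phi> 1 = 1 \<and>
       (\<forall>x. norm (\<phi> x) = norm x) \<and> (range \<phi> = \<real> \<or> range \<phi> = UNIV)"

instance real :: real_or_complex
proof
  show "\<exists>\<phi> :: real \<Rightarrow> complex.
       (\<forall>x y. \<phi> (x + y) = \<phi> x + \<phi> y) \<and> (\<forall>x y. \<phi> (x * y) = \<phi> x * \<phi> y) \<and> \<phi> 1 = 1 \<and>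
       (\<forall>x. norm (\<phi> x) = norm x) \<and> (range \<phi> = \<real> \<or> range \<phi> = UNIV)"
    by (rule exI[of _ complex_of_real]) (auto simp: Reals_def)
qed

instance complex :: real_or_complex
proof
  show "\<exists>\<phi> :: complex \<Rightarrow> complex.
       (\<forall>x y. \<phi> (x + y) = \<phi> x + \<phi> y) \<and> (\<forall>x y. \<phi> (x * y) = \<phi> x * \<phi> y) \<and> \<phi> 1 = 1 \<and>
       (\<forall>x. norm (\<phi> x) = norm x) \<and> (range \<phi> = \<real> \<or> range \<phi> = UNIV)"
    by (rule exI[of _ "\<lambda>x. x"]) auto
qed

text \<open>
  Operators between subspaces. An operator on E is an extensional function, i.e. it takes the
  value undefined outside E, so that equality of operators is equality of functions.
\<close>

definition bounded_ops ::
  "('k \<Rightarrow> 'a \<Rightarrow> 'a) \<Rightarrow> ('k \<Rightarrow> 'b \<Rightarrow> 'b) \<Rightarrow> 'a::real_normed_vector set \<Rightarrow> 'b::real_normed_vector set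
     \<Rightarrow> ('a \<Rightarrow> 'b) set" where
  "bounded_ops s t E F =
     {T \<in> E \<rightarrow>\<^sub>E F. (\<forall>x\<in>E. \<forall>y\<in>E. T (x + y) = T x + T y) \<and> (\<forall>c. \<forall>x\<in>E. T (s c x) = t c (T x)) \<and>
                (\<exists>B. \<forall>x\<in>E. norm (T x) \<le> B * norm x)}"

definition op_norm :: "'a::real_normed_vector set \<Rightarrow> ('a \<Rightarrow> 'b::real_normed_vector) \<Rightarrow> real" where
  "op_norm E T = (SUP x\<in>E. norm (T x) / norm x)"

text \<open>
  HOL has no type of all Banach spaces. The class of Banach spaces is represented by a family
  \<open>spaces U\<close> of complete linear subspaces of one normed space, which is closed under duals.
  (Every set of Banach spaces embeds isometrically in a single normed space, its direct sum.)
  Since functionals on E are not elements of that normed space, \<open>code U E\<close> maps the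
  space of all bounded functionals on E, with the operator norm, linearly and isometrically
  onto the member \<open>dual U E\<close> of the family.
\<close>

record ('k, 'v) universe =
  scal :: "'k \<Rightarrow> 'v \<Rightarrow> 'v"
  spaces :: "'v set set"
  code :: "'v set \<Rightarrow> ('v \<Rightarrow> 'k) \<Rightarrow> 'v"

definition ops ::
  "('k::real_or_complex, 'v::real_normed_vector) universe \<Rightarrow> 'v set \<Rightarrow> 'v set \<Rightarrow> ('v \<Rightarrow> 'v) set" where
  "ops U E F = bounded_ops (scal U) (scal U) E F"

definition functionals ::
  "('k::real_or_complex, 'v::real_normed_vector) universe \<Rightarrow> 'v set \<Rightarrow> ('v \<Rightarrow> 'k) set" where
  "functionals U E = bounded_ops (scal U) (*) E UNIV"

definition dual ::
  "('k::real_or_complex, 'v::real_normed_vector) universe \<Rightarrow> 'v set \<Rightarrow> 'v set" where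
  "dual U E = code U E ` functionals U E"

definition banach_universe ::
  "('k::real_or_complex, 'v::real_normed_vector) universe \<Rightarrow> bool" where
  "banach_universe U \<longleftrightarrow>
     vector_space (scal U) \<and>
     (\<forall>c x. norm (scal U c x) = norm c * norm x) \<and>
     (\<forall>r x. scal U (of_real r) x = r *\<^sub>R x) \<and>
     (\<forall>E \<in> spaces U.
        module.subspace (scal U) E \<and> complete E \<and>
        (\<forall>f \<in> functionals U E. \<forall>g \<in> functionals U E.
           code U E (\<lambda>x\<in>E. f x + g x) = code U E f + code U E g) \<and>
        (\<forall>c. \<forall>f \<in> functionals U E. code U E (\<lambda>x\<in>E. c * f x) = scal U c (code U E f)) \<and>
        (\<forall>f \<in> functionals U E. norm (code U E f) = op_norm E f) \<and>
        dual U E \<in> spaces U)"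

definition as_functional ::
  "('k::real_or_complex, 'v::real_normed_vector) universe \<Rightarrow> 'v set \<Rightarrow> 'v \<Rightarrow> ('v \<Rightarrow> 'k)" where
  "as_functional U E = the_inv_into (functionals U E) (code U E)"

definition adjoint_op ::
  "('k::real_or_complex, 'v::real_normed_vector) universe \<Rightarrow> 'v set \<Rightarrow> 'v set \<Rightarrow> ('v \<Rightarrow> 'v)
     \<Rightarrow> ('v \<Rightarrow> 'v)" where
  "adjoint_op U E F S = (\<lambda>\<phi>\<in>dual U F. code U E (compose E (as_functional U F \<phi>) S))"

definition bidual_embedding ::
  "('k::real_or_complex, 'v::real_normed_vector) universe \<Rightarrow> 'v set \<Rightarrow> ('v \<Rightarrow> 'v)" where
  "bidual_embedding U E =
     (\<lambda>x\<in>E. code U (dual U E) (\<lambda>\<phi>\<in>dual U E. as_functional U E \<phi> x))"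

definition reflexive ::
  "('k::real_or_complex, 'v::real_normed_vector) universe \<Rightarrow> 'v set \<Rightarrow> bool" where
  "reflexive U E \<longleftrightarrow> bidual_embedding U E ` E = dual U (dual U E)"

definition finite_rank_ops ::
  "('k::real_or_complex, 'v::real_normed_vector) universe \<Rightarrow> 'v set \<Rightarrow> 'v set \<Rightarrow> ('v \<Rightarrow> 'v) set" where
  "finite_rank_ops U E F =
     {T \<in> ops U E F. \<exists>B. finite B \<and> T ` E \<subseteq> module.span (scal U) B}"

text \<open>A class of operators is given by its components I E F.\<close>

type_synonym 'v op_class = "'v set \<Rightarrow> 'v set \<Rightarrow> ('v \<Rightarrow> 'v) set"

definition operator_ideal ::
  "('k::real_or_complex, 'v::real_normed_vector) universe \<Rightarrow> 'v op_class \<Rightarrow> bool" where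
  "operator_ideal U I \<longleftrightarrow>
     (\<forall>E \<in> spaces U. \<forall>F \<in> spaces U.
        I E F \<subseteq> ops U E F \<and>
        finite_rank_ops U E F \<subseteq> I E F \<and>
        (\<forall>S \<in> I E F. \<forall>T \<in> I E F. (\<lambda>x\<in>E. S x + T x) \<in> I E F) \<and>
        (\<forall>c. \<forall>T \<in> I E F. (\<lambda>x\<in>E. scal U c (T x)) \<in> I E F)) \<and>
     (\<forall>E \<in> spaces U. \<forall>F \<in> spaces U. \<forall>G \<in> spaces U. \<forall>H \<in> spaces U.
        \<forall>T \<in> ops U E F. \<forall>R \<in> I F G. \<forall>S \<in> ops U G H.
          compose E S (compose E R T) \<in> I E H)"

definition dual_ideal ::
  "('k::real_or_complex, 'v::real_normed_vector) universe \<Rightarrow> 'v op_class \<Rightarrow> 'v op_class" where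
  "dual_ideal U I E F = {S \<in> ops U E F. adjoint_op U E F S \<in> I (dual U F) (dual U E)}"

definition op_class_subset ::
  "('k::real_or_complex, 'v::real_normed_vector) universe \<Rightarrow> 'v op_class \<Rightarrow> 'v op_class \<Rightarrow> bool" where
  "op_class_subset U I J \<longleftrightarrow> (\<forall>E \<in> spaces U. \<forall>F \<in> spaces U. I E F \<subseteq> J E F)"

text \<open>The topology of uniform convergence on compact sets.\<close>

definition tau_c ::
  "('k::real_or_complex, 'v::real_normed_vector) universe \<Rightarrow> 'v set \<Rightarrow> 'v set \<Rightarrow> ('v \<Rightarrow> 'v) topology" where
  "tau_c U E F =
     topology_generated_by
       {{S \<in> ops U E F. \<forall>x\<in>C. norm (S x - T x) < \<epsilon>} | T C \<epsilon>.
          T \<in> ops U E F \<and> C \<subseteq> E \<and> compact C \<and> \<epsilon> > 0}"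

definition approximation_property ::
  "('k::real_or_complex, 'v::real_normed_vector) universe \<Rightarrow> 'v op_class \<Rightarrow> 'v set \<Rightarrow> bool" where
  "approximation_property U I E \<longleftrightarrow> ops U E E = tau_c U E E closure_of I E E"

end

theory Submission
  imports Defs
begin

text \<open>
  By the ideal property, a space \<open>X\<close> has the \<open>I\<close>-approximation property as soon as its
  identity is a \<open>\<tau>\<^sub>c\<close>-limit of operators in \<open>I X X\<close> (\<open>approximation_property_iff\<close>). In both
  parts this is shown by passing from approximations of the identity of a dual space to
  approximations of the identity of the space itself.

  The passage is the lemma \<open>uniform_approximation\<close>: let \<open>\<S>\<close> be a linear space of operators on
  \<open>X\<close> whose adjoints approximate the identity of \<open>X'\<close> uniformly on null sequences; then \<open>\<S>\<close>
  approximates the identity of \<open>X\<close> uniformly on compact sets. For the proof, a compact set is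
  controlled by a null sequence \<open>y\<close> (\<open>compact_null_sequence\<close>), so it suffices that \<open>y\<close> has
  distance 0 to the subspace \<open>{(S (y n))\<^sub>n | S \<in> \<S>}\<close> of \<open>c\<^sub>0(X)\<close>. Otherwise the Hahn-Banach theorem
  gives an absolutely summable sequence of real-linear functionals \<open>g n\<close> for which
  \<open>(\<Sum>n. g n (y n - S (y n)))\<close> is a positive constant independent of \<open>S \<in> \<S>\<close> (\<open>c0_separation\<close>).
  Each \<open>g n\<close> is dominated by some \<open>\<phi> n \<in> X'\<close> of norm at most twice that of \<open>g n\<close>
  (\<open>scalar_extension\<close>). Writing \<open>\<phi> n = a n \<cdot> \<psi> n\<close> with \<open>a\<close> summable and \<open>\<psi>\<close> null
  (\<open>summable_null_factor\<close>), the sum is at most \<open>(\<Sum>n. a n \<cdot> \<bar>(\<psi> n - S' (\<psi> n)) (y n)\<bar>)\<close>, which is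
  arbitrarily small for a suitable \<open>S\<close>: a contradiction.

  Let \<open>J\<close> be the canonical isomorphism of the reflexive space \<open>E\<close> onto its bidual. If \<open>E'\<close> has
  the \<open>I\<^sub>2\<close>-approximation property, take for \<open>\<S>\<close> the operators \<open>S\<close> on \<open>E\<close> with \<open>S' \<in> I\<^sub>2\<close>; every
  operator on \<open>E'\<close> is an adjoint, so the hypothesis of the lemma holds. If \<open>E\<close> has it, take
  for \<open>\<S>\<close> the adjoints of the operators in \<open>I\<^sub>2\<close>; the hypothesis of the lemma then follows from
  \<open>R'' = J R J\<^sup>-\<^sup>1\<close>, valid for all operators \<open>R\<close> on \<open>E\<close>. That \<open>\<S>\<close> is contained in \<open>I\<^sub>1\<close> follows
  under either inclusion between the ideals, by the same identity and the ideal property where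
  a second adjoint occurs.
\<close>

section \<open>The Hahn-Banach theorem\<close>

text \<open>
  Sublinear functionals. Only inequality is required for positive homogeneity; equality follows.
\<close>

definition sublinear :: "('a::real_vector \<Rightarrow> real) \<Rightarrow> bool" where
  "sublinear p \<longleftrightarrow> (\<forall>x y. p (x + y) \<le> p x + p y) \<and> (\<forall>c\<ge>0. \<forall>x. p (c *\<^sub>R x) \<le> c * p x)"

lemma sublinear_add: "sublinear p \<Longrightarrow> p (x + y) \<le> p x + p y"
  by (simp add: sublinear_def)

lemma sublinear_scale_le: "sublinear p \<Longrightarrow> c \<ge> 0 \<Longrightarrow> p (c *\<^sub>R x) \<le> c * p x"
  by (simp add: sublinear_def)

lemma sublinear_scale:
  assumes "sublinear p" "c \<ge> 0"
  shows "p (c *\<^sub>R x) = c * p x"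
proof (cases "c = 0")
  case True
  have "p 0 \<le> 0"
    using sublinear_scale_le[OF assms(1), of 0 0] by simp
  moreover have "p 0 \<le> p 0 + p 0"
    using sublinear_add[OF assms(1), of 0 0] by simp
  ultimately show ?thesis using True by simp
next
  case False
  with assms have "c > 0" by simp
  have "p x = p ((1/c) *\<^sub>R c *\<^sub>R x)" using \<open>c > 0\<close> by simp
  also have "\<dots> \<le> (1/c) * p (c *\<^sub>R x)"
    using \<open>c > 0\<close> by (intro sublinear_scale_le[OF assms(1)]) simp
  finally have "c * p x \<le> p (c *\<^sub>R x)" using \<open>c > 0\<close> by (simp add: field_simps)
  moreover have "p (c *\<^sub>R x) \<le> c * p x"
    using assms by (rule sublinear_scale_le)
  ultimately show ?thesis by simp
qed

lemma sublinear_zero: "sublinear p \<Longrightarrow> p 0 = 0"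
  using sublinear_scale[of p 0 0] by simp

lemma sublinear_lower: "sublinear p \<Longrightarrow> - p (- x) \<le> p x"
  using sublinear_add[of p x "- x"] sublinear_zero[of p] by simp

text \<open>
  The functional \<open>q'\<close> is the infimum over \<open>t \<ge> 0\<close> of \<open>q (x + t y) - t q y\<close>. Hence a minimal
  sublinear functional \<open>q\<close> satisfies \<open>q (- y) = - q y\<close> for all \<open>y\<close>, which makes it linear.
\<close>

lemma sublinear_below:
  assumes q: "sublinear q"
  obtains q' where "sublinear q'" "\<And>x. q' x \<le> q x" "q' (- y) \<le> - q y"
proof -
  define h where "h x t = q (x + t *\<^sub>R y) - t * q y" for x t
  define q' where "q' x = (INF t\<in>{0..}. h x t)" for x
  have bdd: "bdd_below (h x ` {0..})" for x
  proof (rule bdd_belowI2[where m="- q (- x)"])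
    fix t :: real assume "t \<in> {0..}"
    then have "t * q y = q ((x + t *\<^sub>R y) + (- x))"
      using sublinear_scale[OF q, of t y] by simp
    also have "\<dots> \<le> q (x + t *\<^sub>R y) + q (- x)" by (rule sublinear_add[OF q])
    finally show "- q (- x) \<le> h x t" by (simp add: h_def)
  qed
  have le: "q' x \<le> h x t" if "t \<ge> 0" for x t
    unfolding q'_def by (rule cINF_lower[OF bdd]) (use that in simp)
  have ge: "m \<le> q' x" if "\<And>t. t \<ge> 0 \<Longrightarrow> m \<le> h x t" for m x
    unfolding q'_def by (rule cINF_greatest) (use that in auto)
  have add: "q' (u + v) \<le> q' u + q' v" for u v
  proof -
    have *: "q' (u + v) \<le> h u s + h v t" if "s \<ge> 0" "t \<ge> 0" for s t
    proof -
      have "q' (u + v) \<le> h (u + v) (s + t)" by (rule le) (use that in simp)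
      also have "\<dots> = q ((u + s *\<^sub>R y) + (v + t *\<^sub>R y)) - (s + t) * q y"
        by (simp add: h_def algebra_simps)
      also have "\<dots> \<le> h u s + h v t"
        using sublinear_add[OF q, of "u + s *\<^sub>R y" "v + t *\<^sub>R y"] by (simp add: h_def algebra_simps)
      finally show ?thesis .
    qed
    have "q' (u + v) - q' v \<le> q' u"
    proof (rule ge)
      fix s :: real assume s: "s \<ge> 0"
      have "q' (u + v) - h u s \<le> q' v"
        by (rule ge) (use *[OF s] in \<open>simp add: algebra_simps\<close>)
      then show "q' (u + v) - q' v \<le> h u s" by simp
    qed
    then show ?thesis by simp
  qed
  have scale: "q' (c *\<^sub>R x) \<le> c * q' x" if c: "c \<ge> 0" for c x
  proof (cases "c = 0")
    case True
    have "q' 0 \<le> h 0 0" by (rule le) simp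
    then show ?thesis using True sublinear_zero[OF q] by (simp add: h_def)
  next
    case False
    with c have c: "c > 0" by simp
    have "(1/c) * q' (c *\<^sub>R x) \<le> q' x"
    proof (rule ge)
      fix t :: real assume "t \<ge> 0"
      then have "q' (c *\<^sub>R x) \<le> h (c *\<^sub>R x) (c * t)" using c by (intro le) simp
      also have "\<dots> = q (c *\<^sub>R (x + t *\<^sub>R y)) - c * t * q y" by (simp add: h_def algebra_simps)
      also have "\<dots> = c * h x t"
        using sublinear_scale[OF q, of c "x + t *\<^sub>R y"] c by (simp add: h_def right_diff_distrib del: scaleR_add_right)
      finally show "(1/c) * q' (c *\<^sub>R x) \<le> h x t" using c by (simp add: field_simps)
    qed
    then show ?thesis using c by (simp add: field_simps)
  qed
  show ?thesis
  proof
    show "sublinear q'" using add scale by (simp add: sublinear_def)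
    show "q' x \<le> q x" for x using le[of 0 x] by (simp add: h_def)
    show "q' (- y) \<le> - q y" using le[of 1 "- y"] sublinear_zero[OF q] by (simp add: h_def)
  qed
qed

text \<open>
  Zorn's lemma: the pointwise infimum of a chain of sublinear functionals below \<open>p\<close> is
  sublinear, being bounded below by \<open>- p (- x)\<close> at \<open>x\<close>.
\<close>

lemma minimal_sublinear:
  assumes p: "sublinear (p :: 'a::real_vector \<Rightarrow> real)"
  obtains m where "sublinear m" "m \<le> p" "\<And>q. sublinear q \<Longrightarrow> q \<le> m \<Longrightarrow> q = m"
proof -
  define A where "A = {q. sublinear q \<and> q \<le> p}"
  have "\<exists>m\<in>A. \<forall>a\<in>A. a \<le> m \<longrightarrow> a = m"
  proof (rule predicate_Zorn)
    show "partial_order_on A (relation_of (\<lambda>a b. b \<le> a) A)"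
      by (rule partial_order_on_relation_ofI) auto
  next
    fix C assume C: "C \<in> Chains (relation_of (\<lambda>a b. b \<le> a) A)"
    then have CA: "C \<subseteq> A" by (rule Chains_relation_of)
    have tot: "a \<le> b \<or> b \<le> a" if "a \<in> C" "b \<in> C" for a b
      using C that by (auto simp: Chains_def relation_of_def)
    show "\<exists>u\<in>A. \<forall>a\<in>C. u \<le> a"
    proof (cases "C = {}")
      case True
      then show ?thesis using p by (auto simp: A_def)
    next
      case False
      define u where "u x = (INF q\<in>C. q x)" for x
      have bdd: "bdd_below ((\<lambda>q. q x) ` C)" for x
      proof (rule bdd_belowI2[where m="- p (- x)"])
        fix q assume "q \<in> C"
        then have "sublinear q" "q (- x) \<le> p (- x)" using CA by (auto simp: A_def le_fun_def)
        then show "- p (- x) \<le> q x" using sublinear_lower[of q x] by simp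
      qed
      have le: "u x \<le> q x" if "q \<in> C" for q x
        unfolding u_def by (rule cINF_lower[OF bdd that])
      have ge: "m \<le> u x" if "\<And>q. q \<in> C \<Longrightarrow> m \<le> q x" for m x
        unfolding u_def by (rule cINF_greatest[OF False]) (rule that)
      have add: "u (x + y) \<le> u x + u y" for x y
      proof -
        have *: "u (x + y) \<le> a x + b y" if "a \<in> C" "b \<in> C" for a b
        proof -
          have "\<exists>c\<in>C. c \<le> a \<and> c \<le> b" using tot[OF that] that by blast
          then obtain c where c: "c \<in> C" "c \<le> a" "c \<le> b" by blast
          then have "sublinear c" using CA by (auto simp: A_def)
          then have "c (x + y) \<le> c x + c y" by (rule sublinear_add)
          also have "\<dots> \<le> a x + b y" using c by (intro add_mono) (auto simp: le_fun_def)
          finally show ?thesis using le[OF c(1), of "x + y"] by simp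
        qed
        have "u (x + y) - u y \<le> u x"
        proof (rule ge)
          fix a assume a: "a \<in> C"
          have "u (x + y) - a x \<le> u y"
            by (rule ge) (use *[OF a] in \<open>simp add: algebra_simps\<close>)
          then show "u (x + y) - u y \<le> a x" by simp
        qed
        then show ?thesis by simp
      qed
      have scale: "u (c *\<^sub>R x) \<le> c * u x" if c: "c \<ge> 0" for c x
      proof (cases "c = 0")
        case True
        obtain q where "q \<in> C" using False by blast
        then have "u 0 \<le> q 0" "q 0 = 0" using le CA sublinear_zero by (auto simp: A_def)
        then show ?thesis using True by simp
      next
        case False
        with c have c: "c > 0" by simp
        have "(1/c) * u (c *\<^sub>R x) \<le> u x"
        proof (rule ge)
          fix q assume q: "q \<in> C"
          then have "u (c *\<^sub>R x) \<le> q (c *\<^sub>R x)" by (rule le)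
          also have "\<dots> = c * q x" using q CA c by (intro sublinear_scale) (auto simp: A_def)
          finally show "(1/c) * u (c *\<^sub>R x) \<le> q x" using c by (simp add: field_simps)
        qed
        then show ?thesis using c by (simp add: field_simps)
      qed
      obtain q0 where "q0 \<in> C" using False by blast
      then have "q0 \<le> p" "u \<le> q0" using le CA by (auto simp: A_def le_fun_def)
      then have "u \<le> p" by order
      then have "u \<in> A" using add scale by (simp add: A_def sublinear_def)
      moreover have "\<forall>a\<in>C. u \<le> a" using le by (simp add: le_fun_def)
      ultimately show ?thesis by blast
    qed
  qed
  then obtain m where m: "m \<in> A" "\<And>a. a \<in> A \<Longrightarrow> a \<le> m \<Longrightarrow> a = m" by blast
  show ?thesis
  proof
    show "sublinear m" "m \<le> p" using m(1) by (auto simp: A_def)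
    fix q assume q: "sublinear q" "q \<le> m"
    moreover have "q \<le> p" using q(2) \<open>m \<le> p\<close> by order
    ultimately show "q = m" by (intro m(2)) (simp_all add: A_def)
  qed
qed

lemma Hahn_Banach_sublinear:
  assumes p: "sublinear (p :: 'a::real_vector \<Rightarrow> real)"
  obtains f where "linear f" "\<And>x. f x \<le> p x" "f y = p y"
proof -
  obtain p' where p': "sublinear p'" "\<And>x. p' x \<le> p x" "p' (- y) \<le> - p y"
    using sublinear_below[OF p, of y] by blast
  obtain f where f: "sublinear f" "f \<le> p'" and min: "\<And>q. sublinear q \<Longrightarrow> q \<le> f \<Longrightarrow> q = f"
    using minimal_sublinear[OF p'(1)] by blast
  have neg: "f (- x) = - f x" for x
  proof -
    obtain q where q: "sublinear q" "\<And>x. q x \<le> f x" "q (- x) \<le> - f x"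
      using sublinear_below[OF f(1), of x] by blast
    then have "q = f" by (intro min) (auto simp: le_fun_def)
    with q(3) sublinear_lower[OF f(1), of "- x"] show ?thesis by simp
  qed
  have add: "f (x + z) = f x + f z" for x z
    using sublinear_add[OF f(1), of x z] sublinear_add[OF f(1), of "- x" "- z"] neg[of "x + z"]
    by (simp add: neg)
  have scale: "f (c *\<^sub>R x) = c * f x" for c x
  proof (cases "c \<ge> 0")
    case True
    then show ?thesis by (rule sublinear_scale[OF f(1)])
  next
    case False
    then have "f ((- c) *\<^sub>R x) = (- c) * f x" by (intro sublinear_scale[OF f(1)]) simp
    then show ?thesis using neg[of "c *\<^sub>R x"] by simp
  qed
  have fp': "f x \<le> p' x" for x using f(2) by (simp add: le_fun_def)
  have le: "f x \<le> p x" for x using fp'[of x] p'(2)[of x] by simp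
  show ?thesis
  proof
    show "linear f" using add scale by (intro linearI) auto
    show "f x \<le> p x" for x by (rule le)
    have "f (- y) \<le> - p y" using fp'[of "- y"] p'(3) by simp
    then show "f y = p y" using le[of y] neg[of y] by simp
  qed
qed

text \<open>
  The distance to a subspace is a sublinear functional that vanishes on the subspace.
\<close>

lemma Hahn_Banach_distance:
  fixes N :: "'a::real_normed_vector set"
  assumes N: "subspace N"
  obtains f where "linear f" "\<And>x. \<bar>f x\<bar> \<le> norm x" "\<And>x. x \<in> N \<Longrightarrow> f x = 0" "f y = infdist y N"
proof -
  have zero: "0 \<in> N" and ne: "N \<noteq> {}" using subspace_0[OF N] by auto
  have approx: "\<exists>a\<in>N. norm (x - a) < infdist x N + e" if "e > 0" for x e
  proof -
    have "(INF a\<in>N. dist x a) < infdist x N + e" using ne that by (simp add: infdist_notempty)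
    then obtain a where "a \<in> N" "dist x a < infdist x N + e"
      using cInf_lessD[of "dist x ` N"] ne by auto
    then show ?thesis by (auto simp: dist_norm)
  qed
  have sub: "sublinear (\<lambda>x. infdist x N)"
    unfolding sublinear_def
  proof (intro conjI allI impI)
    fix x z
    show "infdist (x + z) N \<le> infdist x N + infdist z N"
    proof (rule field_le_epsilon)
      fix e :: real assume e: "e > 0"
      obtain a where a: "a \<in> N" "norm (x - a) < infdist x N + e/2" using approx[of "e/2" x] e by auto
      obtain b where b: "b \<in> N" "norm (z - b) < infdist z N + e/2" using approx[of "e/2" z] e by auto
      have "infdist (x + z) N \<le> norm ((x - a) + (z - b))"
        using infdist_le[of "a + b" N "x + z"] subspace_add[OF N a(1) b(1)]
        by (simp add: dist_norm algebra_simps)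
      also have "\<dots> \<le> norm (x - a) + norm (z - b)" by (rule norm_triangle_ineq)
      finally show "infdist (x + z) N \<le> infdist x N + infdist z N + e" using a b by simp
    qed
  next
    fix c :: real and x :: 'a assume c: "c \<ge> 0"
    show "infdist (c *\<^sub>R x) N \<le> c * infdist x N"
    proof (rule field_le_epsilon)
      fix e :: real assume e: "e > 0"
      obtain a where a: "a \<in> N" "norm (x - a) < infdist x N + e / (c + 1)"
        using approx[of "e/(c+1)" x] e c by auto
      have "infdist (c *\<^sub>R x) N \<le> norm (c *\<^sub>R (x - a))"
        using infdist_le[of "c *\<^sub>R a" N "c *\<^sub>R x"] subspace_scale[OF N a(1)]
        by (simp add: dist_norm algebra_simps)
      also have "\<dots> \<le> c * (infdist x N + e / (c + 1))" using a c by (simp add: mult_left_mono)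
      also have "\<dots> \<le> c * infdist x N + e" using c e by (simp add: field_simps)
      finally show "infdist (c *\<^sub>R x) N \<le> c * infdist x N + e" .
    qed
  qed
  obtain f where f: "linear f" "\<And>x. f x \<le> infdist x N" "f y = infdist y N"
    using Hahn_Banach_sublinear[OF sub] by blast
  have le: "f x \<le> norm x" for x
    using f(2)[of x] infdist_le[OF zero, of x] by simp
  show ?thesis
  proof
    show "linear f" "f y = infdist y N" by fact+
    show "\<bar>f x\<bar> \<le> norm x" for x using le[of x] le[of "- x"] linear_neg[OF f(1), of x] by simp
    show "f x = 0" if "x \<in> N" for x
      using f(2)[of x] f(2)[of "- x"] that subspace_neg[OF N that] linear_neg[OF f(1), of x] by simp
  qed
qed

lemma norming_real_functional:
  fixes v :: "'a::real_normed_vector"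
  obtains f where "bounded_linear f" "\<And>x. \<bar>f x\<bar> \<le> norm x" "f v = norm v"
proof -
  obtain f :: "'a \<Rightarrow> real" where f: "linear f" "\<And>x. \<bar>f x\<bar> \<le> norm x" "f v = infdist v {0}"
    using Hahn_Banach_distance[of "{0}" v] by (metis subspace_single_0)
  have "bounded_linear f"
    using f(1,2) by (intro bounded_linear_intro[where K=1]) (auto simp: linear_add linear_scale)
  with f show ?thesis using that by simp
qed

section \<open>Null sequences and compact sets\<close>

lemma compact_insert_limit:
  fixes f :: "nat \<Rightarrow> 'a::topological_space"
  assumes "f \<longlonglongrightarrow> l"
  shows "compact (insert l (range f))"
proof (rule compactI)
  fix \<C> :: "'a set set"
  assume op: "\<forall>B\<in>\<C>. open B" and cov: "insert l (range f) \<subseteq> \<Union>\<C>"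
  then obtain L where L: "L \<in> \<C>" "l \<in> L" by blast
  then have "eventually (\<lambda>n. f n \<in> L) sequentially" using assms op by (auto simp: tendsto_def)
  then obtain m where m: "\<And>n. n \<ge> m \<Longrightarrow> f n \<in> L" by (auto simp: eventually_sequentially)
  have "\<forall>n. \<exists>B\<in>\<C>. f n \<in> B" using cov by blast
  then obtain B where B: "\<And>n. B n \<in> \<C>" "\<And>n. f n \<in> B n" by metis
  have "f n \<in> L \<union> \<Union>(B ` {..<m})" for n
    using m[of n] B(2)[of n] by (cases "n < m") auto
  then have "insert l (range f) \<subseteq> \<Union>(insert L (B ` {..<m}))" using L by auto
  moreover have "insert L (B ` {..<m}) \<subseteq> \<C>" "finite (insert L (B ` {..<m}))"
    using L B by auto
  ultimately show "\<exists>\<C>'\<subseteq>\<C>. finite \<C>' \<and> insert l (range f) \<subseteq> \<Union>\<C>'" by blast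
qed

text \<open>
  The values 0 outside the range of the enumeration make the statement hold for finite \<open>D\<close> too.
\<close>

lemma null_enumeration:
  fixes D :: "'a::real_normed_vector set"
  assumes c: "countable D" and fin: "\<And>e. e > 0 \<Longrightarrow> finite {d\<in>D. norm d \<ge> e}"
  obtains y :: "nat \<Rightarrow> 'a" where "y \<longlonglongrightarrow> 0" "D \<subseteq> range y" "range y \<subseteq> insert 0 D"
proof
  define y where "y n = (if n \<in> to_nat_on D ` D then from_nat_into D n else 0)" for n
  show "range y \<subseteq> insert 0 D" by (auto simp: y_def c)
  show "D \<subseteq> range y"
  proof
    fix d assume "d \<in> D"
    then have "y (to_nat_on D d) = d" by (simp add: y_def c)
    then show "d \<in> range y" by (metis rangeI)
  qed
  show "y \<longlonglongrightarrow> 0"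
  proof (rule tendstoI)
    fix e :: real assume e: "e > 0"
    have "{n. \<not> dist (y n) 0 < e} \<subseteq> to_nat_on D ` {d\<in>D. norm d \<ge> e}"
    proof
      fix n assume n: "n \<in> {n. \<not> dist (y n) 0 < e}"
      then have "n \<in> to_nat_on D ` D" using e by (auto simp: y_def split: if_splits)
      then obtain d where "d \<in> D" "n = to_nat_on D d" by blast
      then show "n \<in> to_nat_on D ` {d\<in>D. norm d \<ge> e}" using n by (auto simp: y_def c)
    qed
    then have "finite {n. \<not> dist (y n) 0 < e}" using fin[OF e] finite_subset by blast
    then show "\<forall>\<^sub>F n in sequentially. dist (y n) 0 < e"
      by (simp flip: cofinite_eq_sequentially add: eventually_cofinite)
  qed
qed

text \<open>
  Grothendieck's description of compact sets, with weights \<open>2\<^sup>-\<^sup>k\<close> summing to 2. A point of \<open>C\<close> is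
  the telescoping sum of the differences of its approximants in finite \<open>4\<^sup>-\<^sup>k\<close>-nets of \<open>C\<close>; the
  differences at level \<open>k\<close>, multiplied by \<open>2\<^sup>k\<close>, form a finite set of vectors of norm \<open>O(2\<^sup>-\<^sup>k)\<close>.
\<close>

lemma compact_null_sequence:
  fixes C :: "'a::real_normed_vector set"
  assumes C: "compact C" and E: "subspace E" and CE: "C \<subseteq> E"
  obtains y :: "nat \<Rightarrow> 'a" where "range y \<subseteq> E" "y \<longlonglongrightarrow> 0"
    "\<And>x. x \<in> C \<Longrightarrow> \<exists>i. (\<lambda>k. (1/2)^k *\<^sub>R y (i k)) sums x"
proof -
  have "\<forall>k::nat. \<exists>A. finite A \<and> A \<subseteq> C \<and> C \<subseteq> (\<Union>a\<in>A. ball a ((1/4)^k))"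
    using seq_compact_imp_totally_bounded[of C] C by (simp add: compact_eq_seq_compact_metric)
  then obtain A where A: "\<And>k. finite (A k)" "\<And>k. A k \<subseteq> C"
    "\<And>k::nat. C \<subseteq> (\<Union>a\<in>A k. ball a ((1/4)^k))" by metis
  define D where "D k = (case k of 0 \<Rightarrow> A 0 | Suc k \<Rightarrow>
      (\<lambda>(a,b). 2^Suc k *\<^sub>R (a - b)) ` {(a,b). a \<in> A (Suc k) \<and> b \<in> A k \<and> norm (a - b) \<le> 2 * (1/4)^k})" for k
  have finD: "finite (D k)" for k
  proof (cases k)
    case (Suc j)
    have "finite {(a,b). a \<in> A (Suc j) \<and> b \<in> A j \<and> norm (a - b) \<le> 2 * (1/4)^j}"
      by (rule finite_subset[of _ "A (Suc j) \<times> A j"]) (use A in auto)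
    then show ?thesis by (simp add: D_def Suc)
  qed (simp add: D_def A)
  have DE: "D k \<subseteq> E" for k
  proof (cases k)
    case 0
    then show ?thesis using A(2)[of 0] CE by (auto simp: D_def)
  next
    case (Suc j)
    then show ?thesis using A(2) CE
      by (force simp: D_def intro!: subspace_scale[OF E] subspace_diff[OF E])
  qed
  have normD: "norm d \<le> 4 * (1/2)^j" if "d \<in> D (Suc j)" for d j
  proof -
    obtain a b where ab: "d = 2^Suc j *\<^sub>R (a - b)" "norm (a - b) \<le> 2 * (1/4)^j"
      using \<open>d \<in> D (Suc j)\<close> by (auto simp: D_def)
    have "norm d = 2^Suc j * norm (a - b)" using ab(1) by simp
    also have "\<dots> \<le> 2^Suc j * (2 * (1/4)^j)" by (rule mult_left_mono[OF ab(2)]) simp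
    also have "\<dots> = 4 * (2 * (1/4))^j" by (simp only: power_mult_distrib) simp
    finally show ?thesis by simp
  qed
  define DD where "DD = (\<Union>k. D k)"
  have "countable DD" unfolding DD_def using finD by (simp add: countable_finite)
  moreover have "finite {d\<in>DD. norm d \<ge> e}" if e: "e > 0" for e
  proof -
    have "(\<lambda>j. 4 * (1/2)^j :: real) \<longlonglongrightarrow> 4 * 0" by (intro tendsto_intros LIMSEQ_power_zero) simp
    then have "\<forall>\<^sub>F j in sequentially. 4 * (1/2)^j < e" using e by (intro order_tendstoD) auto
    then obtain m where m: "\<And>j. j \<ge> m \<Longrightarrow> 4 * (1/2)^j < e" by (auto simp: eventually_sequentially)
    have "{d\<in>DD. norm d \<ge> e} \<subseteq> (\<Union>k\<in>{..m}. D k)"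
    proof
      fix d assume "d \<in> {d\<in>DD. norm d \<ge> e}"
      then obtain k where k: "d \<in> D k" "norm d \<ge> e" by (auto simp: DD_def)
      have "k \<le> m"
      proof (rule ccontr)
        assume "\<not> k \<le> m"
        then have "k = Suc (k - 1)" "k - 1 \<ge> m" by auto
        then show False using normD[of d "k - 1"] m[of "k - 1"] k by simp
      qed
      then show "d \<in> (\<Union>k\<in>{..m}. D k)" using k by blast
    qed
    then show ?thesis using finD finite_subset by blast
  qed
  ultimately obtain y :: "nat \<Rightarrow> 'a" where y: "y \<longlonglongrightarrow> 0" "DD \<subseteq> range y" "range y \<subseteq> insert 0 DD"
    using null_enumeration by blast
  show ?thesis
  proof
    have "insert 0 DD \<subseteq> E" using DE subspace_0[OF E] by (auto simp: DD_def)
    then show "range y \<subseteq> E" using y(3) by blast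
    show "y \<longlonglongrightarrow> 0" by fact
    fix x assume x: "x \<in> C"
    have "\<forall>k. \<exists>a\<in>A k. dist a x < (1/4)^k" using A(3) x by fastforce
    then obtain a where a: "\<And>k. a k \<in> A k" "\<And>k. dist (a k) x < (1/4)^k" by metis
    define u where "u k = (case k of 0 \<Rightarrow> a 0 | Suc j \<Rightarrow> a (Suc j) - a j)" for k
    have "2^k *\<^sub>R u k \<in> D k" for k
    proof (cases k)
      case 0
      then show ?thesis using a(1) by (simp add: D_def u_def)
    next
      case (Suc j)
      have "norm (a (Suc j) - a j) \<le> dist (a (Suc j)) x + dist (a j) x"
        by (metis dist_norm dist_triangle2)
      also have "\<dots> \<le> (1/4)^Suc j + (1/4)^j" using a(2)[of j] a(2)[of "Suc j"] by linarith
      also have "\<dots> \<le> 2 * (1/4)^j" by simp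
      finally show ?thesis unfolding Suc D_def u_def using a(1)[of j] a(1)[of "Suc j"] by force
    qed
    then have "\<forall>k. \<exists>n. y n = 2^k *\<^sub>R u k" using y(2) by (metis (no_types) DD_def UN_iff UNIV_I imageE subsetD)
    then obtain i where i: "\<And>k. y (i k) = 2^k *\<^sub>R u k" by metis
    have eq: "(1/2)^k *\<^sub>R y (i k) = u k" for k by (simp add: i power_one_over)
    have sum: "(\<Sum>k<Suc n. u k) = a n" for n by (induction n) (auto simp: u_def)
    have "a \<longlonglongrightarrow> x"
    proof (rule metric_LIMSEQ_I)
      fix e :: real assume e: "e > 0"
      have "(\<lambda>k. (1/4)^k :: real) \<longlonglongrightarrow> 0" by (intro LIMSEQ_power_zero) simp
      then have "\<forall>\<^sub>F k in sequentially. (1/4)^k < e" using e by (intro order_tendstoD) auto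
      then show "\<exists>no. \<forall>n\<ge>no. dist (a n) x < e"
        using a(2) by (meson eventually_sequentially less_trans)
    qed
    then have "(\<lambda>n. \<Sum>k<n. u k) \<longlonglongrightarrow> x"
      by (simp only: sum flip: filterlim_sequentially_Suc[of "\<lambda>n. \<Sum>k<n. u k"])
    then have "u sums x" by (simp add: sums_def)
    then show "\<exists>i. (\<lambda>k. (1/2)^k *\<^sub>R y (i k)) sums x" using eq by (intro exI[of _ i]) simp
  qed
qed

text \<open>
  A summable sequence is the product of a summable and a null sequence. The null factor is the
  square root \<open>s\<close> of the tail sums, as \<open>b n / s n \<le> 2 (s n - s (Suc n))\<close> telescopes.
\<close>

lemma summable_null_factor:
  fixes b :: "nat \<Rightarrow> real"
  assumes b: "\<And>n. b n \<ge> 0" "summable b"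
  obtains a s :: "nat \<Rightarrow> real" where "summable a" "s \<longlonglongrightarrow> 0" "\<And>n. a n \<ge> 0" "\<And>n. s n \<ge> 0" "\<And>n. b n = a n * s n"
proof -
  define r where "r n = (\<Sum>k. b (k + n))" for n
  define s where "s n = sqrt (r n)" for n
  define a where "a n = b n / s n" for n
  have r0: "r n \<ge> 0" for n
    unfolding r_def using b by (intro suminf_nonneg summable_ignore_initial_segment) auto
  have rS: "b n = r n - r (Suc n)" for n
    using suminf_split_head[OF summable_ignore_initial_segment[OF b(2), of n]] by (simp add: r_def)
  have "r \<longlonglongrightarrow> 0" unfolding r_def by (rule suminf_exist_split2[OF b(2)])
  then have s0: "s \<longlonglongrightarrow> 0" unfolding s_def using tendsto_real_sqrt by fastforce
  have bs: "b n = a n * s n" for n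
  proof (cases "s n = 0")
    case True
    then have "r n = 0" by (simp add: s_def)
    then have "b n = 0" using rS[of n] r0[of "Suc n"] b(1)[of n] by linarith
    then show ?thesis by (simp add: a_def)
  qed (simp add: a_def)
  have sn: "s n \<ge> 0" for n using r0 by (simp add: s_def)
  have an: "a n \<ge> 0" for n using b sn by (simp add: a_def)
  have step: "a n \<le> 2 * (s n - s (Suc n))" for n
  proof (cases "s n = 0")
    case True
    have "r n = 0" using True by (simp add: s_def)
    then have "r (Suc n) = 0" using rS[of n] r0[of "Suc n"] b(1)[of n] by linarith
    then show ?thesis using True by (simp add: a_def s_def)
  next
    case False
    then have pos: "s n > 0" using sn[of n] by simp
    have le: "s (Suc n) \<le> s n" using rS[of n] b(1)[of n] by (simp add: s_def)
    have "b n = (s n)\<^sup>2 - (s (Suc n))\<^sup>2" using rS[of n] r0 by (simp add: s_def)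
    also have "\<dots> = (s n - s (Suc n)) * (s n + s (Suc n))" by (simp add: power2_eq_square algebra_simps)
    also have "\<dots> \<le> (s n - s (Suc n)) * (2 * s n)" using le by (intro mult_left_mono) auto
    finally show ?thesis using pos by (simp add: a_def field_simps)
  qed
  have "summable (\<lambda>n. 2 * (s n - s (Suc n)))"
    using telescope_summable'[OF s0] by (intro summable_mult)
  then have "summable a" by (rule summable_comparison_test'[where N=0]) (use step an in auto)
  then show ?thesis using that s0 an sn bs by blast
qed

section \<open>Separation in the space of null sequences\<close>

text \<open>
  A null sequence \<open>y\<close> at positive distance from a subspace \<open>N\<close> of the null sequences is separated
  from it by an absolutely summable sequence of functionals \<open>g n\<close>. The Hahn-Banach functional lives on
  all bounded sequences; its restriction to the sequences supported at \<open>n\<close> is \<open>g n\<close>, and it is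
  given by the series of the \<open>g n\<close> on null sequences.
\<close>

lemma c0_separation:
  fixes N :: "(nat \<Rightarrow> 'v::real_normed_vector) set" and y :: "nat \<Rightarrow> 'v"
  assumes y: "y \<longlonglongrightarrow> 0"
    and N0: "\<And>z. z \<in> N \<Longrightarrow> z \<longlonglongrightarrow> 0" and zero: "(\<lambda>n. 0) \<in> N"
    and add: "\<And>z w. z \<in> N \<Longrightarrow> w \<in> N \<Longrightarrow> (\<lambda>n. z n + w n) \<in> N"
    and scale: "\<And>c z. z \<in> N \<Longrightarrow> (\<lambda>n. c *\<^sub>R z n) \<in> N"
    and e: "e > 0" and far: "\<And>z. z \<in> N \<Longrightarrow> \<exists>n. norm (z n - y n) \<ge> e"
  shows "\<exists>(g :: nat \<Rightarrow> 'v \<Rightarrow> real) d. (\<forall>n. bounded_linear (g n)) \<and> summable (\<lambda>n. onorm (g n)) \<and> d > 0 \<and>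
    (\<forall>z\<in>N. (\<lambda>n. g n (y n - z n)) sums d)"
proof -
  define L where "L z = (Bcontfun z :: nat \<Rightarrow>\<^sub>C 'v)" for z
  define bd where "bd z \<longleftrightarrow> bounded (range z)" for z :: "nat \<Rightarrow> 'v"
  have app: "apply_bcontfun (L z) = z" if "bd z" for z
    unfolding L_def by (rule Bcontfun_inverse) (use that in \<open>simp add: bcontfun_def bd_def\<close>)
  have bd0: "bd z" if "z \<longlonglongrightarrow> 0" for z
    unfolding bd_def by (rule convergent_imp_bounded[OF that])
  have bdI: "bd z" if "\<And>n. norm (z n) \<le> B" for z B
    unfolding bd_def bounded_iff using that by auto
  have bdD: "\<exists>B. \<forall>n. norm (z n) \<le> B" if "bd z" for z
    using that unfolding bd_def bounded_iff by auto
  have bdm: "bd (\<lambda>n. if P n then z n else 0)" if z: "bd z" for P z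
  proof -
    obtain B where B: "\<And>n. norm (z n) \<le> B" using bdD[OF z] by auto
    have "norm (if P n then z n else 0) \<le> B" for n
      using B[of n] order_trans[OF norm_ge_zero B[of n]] by auto
    then show ?thesis by (rule bdI)
  qed
  have Ladd: "L (\<lambda>n. z n + w n) = L z + L w" if "bd z" "bd w" for z w
  proof -
    have "bd (\<lambda>n. z n + w n)" using that unfolding bd_def by (rule bounded_plus_comp)
    then show ?thesis using that by (intro bcontfun_eqI) (simp add: app)
  qed
  have Lscale: "L (\<lambda>n. c *\<^sub>R z n) = c *\<^sub>R L z" if "bd z" for z c
  proof -
    have "bd (\<lambda>n. c *\<^sub>R z n)" using that unfolding bd_def by (rule bounded_scaleR_comp)
    then show ?thesis using that by (intro bcontfun_eqI) (simp add: app)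
  qed
  have sub: "subspace (L ` N)"
  proof (rule subspaceI)
    have "L (\<lambda>n. 0) = 0" using bdI[of "\<lambda>n. 0" 0] by (intro bcontfun_eqI) (simp add: app)
    then show "0 \<in> L ` N" using zero by (metis image_eqI)
  next
    fix u w assume "u \<in> L ` N" "w \<in> L ` N"
    then obtain a b where ab: "a \<in> N" "b \<in> N" "u = L a" "w = L b" by blast
    then have "u + w = L (\<lambda>n. a n + b n)" using Ladd bd0 N0 by simp
    then show "u + w \<in> L ` N" using add[OF ab(1,2)] by blast
  next
    fix c u assume "u \<in> L ` N"
    then obtain a where a: "a \<in> N" "u = L a" by blast
    then have "c *\<^sub>R u = L (\<lambda>n. c *\<^sub>R a n)" using Lscale bd0 N0 by simp
    then show "c *\<^sub>R u \<in> L ` N" using scale[OF a(1)] by blast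
  qed
  obtain f where f: "linear f" "\<And>x. \<bar>f x\<bar> \<le> norm x" "\<And>x. x \<in> L ` N \<Longrightarrow> f x = 0"
    "f (L y) = infdist (L y) (L ` N)" using Hahn_Banach_distance[OF sub] by blast
  have "L ` N \<noteq> {}" using zero by blast
  then have "e \<le> infdist (L y) (L ` N)"
    unfolding infdist_notempty[OF \<open>L ` N \<noteq> {}\<close>]
  proof (rule cINF_greatest)
    fix w assume "w \<in> L ` N"
    then obtain x where x: "x \<in> N" "w = L x" by blast
    then obtain n where "norm (x n - y n) \<ge> e" using far by blast
    also have "norm (x n - y n) = dist (L y n) (L x n)"
      using x(1) by (simp add: app bd0 N0 y dist_norm norm_minus_commute)
    finally show "e \<le> dist (L y) w" using dist_bounded[of "L y" n "L x"] x(2) by simp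
  qed
  then have fy: "f (L y) > 0" using f(4) e by simp
  define single where "single n v = (\<lambda>k. if k = n then v else (0::'v))" for n :: nat and v
  have bds: "bd (single n v)" for n v by (rule bdI[of _ "norm v"]) (simp add: single_def)
  define g where "g n v = f (L (single n v))" for n v
  have gbl: "bounded_linear (g n)" for n
  proof (rule bounded_linear_intro[where K=1])
    fix v w :: 'v and r :: real
    have "single n (v + w) = (\<lambda>k. single n v k + single n w k)" by (auto simp: single_def)
    then show "g n (v + w) = g n v + g n w" by (simp add: g_def Ladd bds linear_add[OF f(1)])
    have "single n (r *\<^sub>R v) = (\<lambda>k. r *\<^sub>R single n v k)" by (auto simp: single_def)
    then show "g n (r *\<^sub>R v) = r *\<^sub>R g n v" by (simp add: g_def Lscale bds linear_scale[OF f(1)])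
    have "norm (L (single n v)) \<le> norm v"
      by (rule norm_bound) (simp add: app bds, simp add: single_def)
    then show "norm (g n v) \<le> norm v * 1" using f(2)[of "L (single n v)"] by (simp add: g_def)
  qed
  have split: "f (L z) = (\<Sum>n<m. g n (z n)) + f (L (\<lambda>n. if \<not> n < m then z n else 0))" if z: "bd z" for z m
  proof (induction m)
    case (Suc m)
    have "(\<lambda>n. if \<not> n < m then z n else 0) = (\<lambda>n. single m (z m) n + (if \<not> n < Suc m then z n else 0))"
      by (auto simp: single_def fun_eq_iff less_Suc_eq)
    then have "L (\<lambda>n. if \<not> n < m then z n else 0) = L (single m (z m)) + L (\<lambda>n. if \<not> n < Suc m then z n else 0)"
      using Ladd[OF bds bdm[OF z]] by simp
    then show ?case using Suc by (simp add: g_def linear_add[OF f(1)])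
  qed simp
  have expand: "(\<lambda>n. g n (z n)) sums f (L z)" if z: "z \<longlonglongrightarrow> 0" for z
    unfolding sums_def
  proof (rule metric_LIMSEQ_I)
    fix e :: real assume e: "e > 0"
    then obtain k where k: "\<And>n. n \<ge> k \<Longrightarrow> norm (z n) < e/2"
      using LIMSEQ_D[OF z, of "e/2"] by auto
    show "\<exists>k. \<forall>m\<ge>k. dist (\<Sum>n<m. g n (z n)) (f (L z)) < e"
    proof (intro exI allI impI)
      fix m assume m: "m \<ge> k"
      have "norm (L (\<lambda>n. if \<not> n < m then z n else 0)) \<le> e/2"
        by (rule norm_bound) (use k m e in \<open>auto simp: app bdm bd0 z intro: less_imp_le\<close>)
      then show "dist (\<Sum>n<m. g n (z n)) (f (L z)) < e"
        using split[OF bd0[OF z], of m] f(2)[of "L (\<lambda>n. if \<not> n < m then z n else 0)"] e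
        by (simp add: dist_real_def)
    qed
  qed
  \<comment> \<open>Half of the norm of each \<open>g n\<close> is attained on the unit ball, so the partial sums of the
    norms are at most 2.\<close>
  have half: "\<exists>v. norm v \<le> 1 \<and> onorm (g n) / 2 \<le> g n v" for n
  proof (cases "onorm (g n) = 0")
    case True
    then show ?thesis by (intro exI[of _ 0]) (simp add: linear_0[OF bounded_linear.linear[OF gbl]])
  next
    case False
    then have pos: "onorm (g n) > 0" using onorm_pos_le[OF gbl, of n] by simp
    have "\<exists>x. \<not> norm (g n x) \<le> onorm (g n) / 2 * norm x"
    proof (rule ccontr)
      assume "\<not> ?thesis"
      then have "onorm (g n) \<le> onorm (g n) / 2" using pos by (intro onorm_bound) auto
      then show False using pos by simp
    qed
    then obtain x where x: "\<bar>g n x\<bar> > onorm (g n) / 2 * norm x" by (auto simp: not_le)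
    then have "x \<noteq> 0" by (auto simp: linear_0[OF bounded_linear.linear[OF gbl]])
    define v where "v = (sgn (g n x) / norm x) *\<^sub>R x"
    have "norm v \<le> 1" using \<open>x \<noteq> 0\<close> by (simp add: v_def abs_sgn_eq)
    moreover have "g n v = \<bar>g n x\<bar> / norm x"
      by (simp add: v_def linear_scale[OF bounded_linear.linear[OF gbl]] abs_sgn)
    moreover have "onorm (g n) / 2 \<le> \<bar>g n x\<bar> / norm x"
      using x \<open>x \<noteq> 0\<close> by (simp add: pos_le_divide_eq)
    ultimately show ?thesis by (intro exI[of _ v]) simp
  qed
  then obtain v where v: "\<And>n. norm (v n) \<le> 1" "\<And>n. onorm (g n) / 2 \<le> g n (v n)" by metis
  have "(\<Sum>n<m. onorm (g n)) \<le> 2" for m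
  proof -
    define z where "z = (\<lambda>n. if n < m then v n else 0)"
    have z: "bd z" by (rule bdI[of _ 1]) (use v in \<open>auto simp: z_def\<close>)
    have "(\<lambda>n. if \<not> n < m then z n else 0) = (\<lambda>n. 0 *\<^sub>R z n)" by (auto simp: z_def)
    then have "f (L (\<lambda>n. if \<not> n < m then z n else 0)) = 0"
      by (simp only: Lscale[OF z]) (simp add: linear_0[OF f(1)])
    then have "(\<Sum>n<m. g n (v n)) = f (L z)" using split[OF z, of m] by (simp add: z_def)
    also have "\<dots> \<le> norm (L z)" using f(2)[of "L z"] by simp
    also have "\<dots> \<le> 1" by (rule norm_bound) (simp add: app[OF z], use v in \<open>simp add: z_def\<close>)
    finally have "(\<Sum>n<m. g n (v n)) \<le> 1" .
    moreover have "(\<Sum>n<m. onorm (g n) / 2) \<le> (\<Sum>n<m. g n (v n))" by (intro sum_mono v)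
    ultimately show ?thesis by (simp flip: sum_divide_distrib)
  qed
  then have "summable (\<lambda>n. onorm (g n))"
    by (intro summableI_nonneg_bounded[where x=2]) (auto simp: onorm_pos_le[OF gbl])
  moreover have "(\<lambda>n. g n (y n - z n)) sums f (L y)" if "z \<in> N" for z
  proof -
    have "(\<lambda>n. g n (z n)) sums 0" using expand[OF N0[OF that]] f(3) that by simp
    from sums_diff[OF expand[OF y] this] show ?thesis
      by (simp add: linear_diff[OF bounded_linear.linear[OF gbl]])
  qed
  ultimately show ?thesis using gbl fy by blast
qed
section \<open>The scalar field\<close>

text \<open>
  The scalars are the reals, or they are spanned over the reals by 1 and an imaginary unit \<open>i\<close>.
\<close>

lemma scalar_field_cases:
  "(\<forall>c::'k::real_or_complex. \<exists>r. c = of_real r) \<or>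
   (\<exists>i::'k. i * i = - 1 \<and> norm i = 1 \<and> (\<forall>c. \<exists>a b. c = of_real a + of_real b * i) \<and>
      (\<forall>a b. \<bar>a\<bar> \<le> norm (of_real a - of_real b * i)))"
proof -
  obtain h :: "'k \<Rightarrow> complex" where h: "\<And>x y. h (x + y) = h x + h y" "\<And>x y. h (x * y) = h x * h y"
    "h 1 = 1" "\<And>x. norm (h x) = norm x" "range h = \<real> \<or> range h = UNIV"
    using real_or_complex[where 'a='k] by blast
  have diff: "h (x - y) = h x - h y" for x y
    using h(1)[of "x - y" y] by simp
  have inj: "x = y" if "h x = h y" for x y
    using h(4)[of "x - y"] diff[of x y] that by simp
  have real: "h (of_real r) = of_real r" for r
  proof -
    define z where "z = h (of_real r)"
    \<comment> \<open>The distances of \<open>z\<close> to 0 and to 1 are those of \<open>r\<close>, which leaves only \<open>z = r\<close>.\<close>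
    have "cmod z = \<bar>r\<bar>" by (simp add: z_def h)
    then have 1: "(Re z)\<^sup>2 + (Im z)\<^sup>2 = r\<^sup>2" by (metis cmod_power2 power2_abs)
    have "cmod (z - 1) = norm (of_real r - 1 :: 'k)" using diff[of "of_real r" 1] h(3,4) by (simp add: z_def flip: h(4))
    also have "\<dots> = \<bar>r - 1\<bar>" by (metis norm_of_real of_real_1 of_real_diff)
    finally have 2: "(Re z - 1)\<^sup>2 + (Im z)\<^sup>2 = (r - 1)\<^sup>2"
      using cmod_power2[of "z - 1"] by simp
    have "Re z = r" using 1 2 by (simp add: power2_eq_square algebra_simps)
    then have "Im z = 0" using 1 by simp
    with \<open>Re z = r\<close> show ?thesis by (simp add: z_def complex_eq_iff)
  qed
  from h(5) show ?thesis
  proof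
    assume R: "range h = \<real>"
    have "\<exists>r. c = of_real r" for c :: 'k
    proof -
      have "h c \<in> \<real>" using R by blast
      then obtain r where "h c = of_real r" by (auto elim: Reals_cases)
      then have "c = of_real r" using real by (intro inj) simp
      then show ?thesis ..
    qed
    then show ?thesis by blast
  next
    assume R: "range h = UNIV"
    then obtain i where i: "h i = \<i>" by (metis UNIV_I imageE)
    have "i * i = - 1" by (rule inj) (simp add: h i diff[of 0 1, simplified] real[of 0, simplified])
    moreover have "norm i = 1" using h(4)[of i] i by simp
    moreover have "\<exists>a b. c = of_real a + of_real b * i" for c :: 'k
    proof -
      have "h c = h (of_real (Re (h c)) + of_real (Im (h c)) * i)"
        by (simp add: h real i complex_eq_iff)
      then show ?thesis using inj by blast
    qed
    moreover have "\<bar>a\<bar> \<le> norm (of_real a - of_real b * i)" for a b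
    proof -
      have "norm (of_real a - of_real b * i) = cmod (of_real a - of_real b * \<i>)"
        by (simp add: h(2) real i diff flip: h(4))
      then show ?thesis using abs_Re_le_cmod[of "of_real a - of_real b * \<i>"] by simp
    qed
    ultimately show ?thesis by blast
  qed
qed

section \<open>Duality in a universe of Banach spaces\<close>

text \<open>
  A fixed universe of Banach spaces, as the context of the theory of duality.
\<close>

locale banach_space_universe =
  fixes U :: "('k::real_or_complex, 'v::real_normed_vector) universe"
  assumes banach_universe: "banach_universe U"
begin

lemma vector_space_scal: "vector_space (scal U)"
  using banach_universe by (simp add: banach_universe_def)

interpretation vs: vector_space "scal U" by (rule vector_space_scal)

lemma norm_scal: "norm (scal U c x) = norm c * norm x"
  using banach_universe by (simp add: banach_universe_def)

lemma scal_of_real: "scal U (of_real r) x = r *\<^sub>R x"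
  using banach_universe by (simp add: banach_universe_def)

lemma dual_in_spaces: "E \<in> spaces U \<Longrightarrow> dual U E \<in> spaces U"
  using banach_universe by (simp add: banach_universe_def)

lemma subspace_scal: "E \<in> spaces U \<Longrightarrow> vs.subspace E"
  using banach_universe by (simp add: banach_universe_def)

lemma space_scal: "E \<in> spaces U \<Longrightarrow> x \<in> E \<Longrightarrow> scal U c x \<in> E"
  using subspace_scal vs.subspace_scale by blast

lemma real_subspace: "E \<in> spaces U \<Longrightarrow> subspace E"
  using vs.subspace_0[OF subspace_scal] vs.subspace_add[OF subspace_scal] space_scal
  by (intro subspaceI) (auto simp flip: scal_of_real)

lemma code_add:
  "E \<in> spaces U \<Longrightarrow> f \<in> functionals U E \<Longrightarrow> g \<in> functionals U E \<Longrightarrow>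
    code U E (\<lambda>x\<in>E. f x + g x) = code U E f + code U E g"
  using banach_universe by (simp add: banach_universe_def)

lemma code_scal:
  "E \<in> spaces U \<Longrightarrow> f \<in> functionals U E \<Longrightarrow> code U E (\<lambda>x\<in>E. c * f x) = scal U c (code U E f)"
  using banach_universe by (simp add: banach_universe_def)

lemma norm_code: "E \<in> spaces U \<Longrightarrow> f \<in> functionals U E \<Longrightarrow> norm (code U E f) = op_norm E f"
  using banach_universe by (simp add: banach_universe_def)

lemma bounded_opsI:
  assumes E: "E \<in> spaces U" and "\<And>x. x \<in> E \<Longrightarrow> h x \<in> F"
    and "\<And>x y. x \<in> E \<Longrightarrow> y \<in> E \<Longrightarrow> h (x + y) = h x + h y"
    and "\<And>c x. x \<in> E \<Longrightarrow> h (scal U c x) = t c (h x)"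
    and "\<And>x. x \<in> E \<Longrightarrow> norm (h x) \<le> B * norm x"
  shows "restrict h E \<in> bounded_ops (scal U) t E F"
proof -
  have "\<exists>B. \<forall>x\<in>E. norm (restrict h E x) \<le> B * norm x" using assms(5) by auto
  then show ?thesis
    using assms(2-4) subspace_add[OF real_subspace[OF E]] space_scal[OF E]
    by (simp add: bounded_ops_def)
qed

lemmas functionalsI = bounded_opsI[where F=UNIV and t="(*)", folded functionals_def, simplified]
lemmas opsI = bounded_opsI[where t="scal U", folded ops_def]

lemma functionals_add: "f \<in> functionals U E \<Longrightarrow> x \<in> E \<Longrightarrow> y \<in> E \<Longrightarrow> f (x + y) = f x + f y"
  and functionals_scal: "f \<in> functionals U E \<Longrightarrow> x \<in> E \<Longrightarrow> f (scal U c x) = c * f x"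
  and functionals_bound: "f \<in> functionals U E \<Longrightarrow> \<exists>B. \<forall>x\<in>E. norm (f x) \<le> B * norm x"
  and functionals_ext: "f \<in> functionals U E \<Longrightarrow> f \<in> extensional E"
  by (auto simp: functionals_def bounded_ops_def PiE_def)

lemma ops_add: "T \<in> ops U E F \<Longrightarrow> x \<in> E \<Longrightarrow> y \<in> E \<Longrightarrow> T (x + y) = T x + T y"
  and ops_scal: "T \<in> ops U E F \<Longrightarrow> x \<in> E \<Longrightarrow> T (scal U c x) = scal U c (T x)"
  and ops_mem: "T \<in> ops U E F \<Longrightarrow> x \<in> E \<Longrightarrow> T x \<in> F"
  and ops_ext: "T \<in> ops U E F \<Longrightarrow> T \<in> extensional E"
  by (auto simp: ops_def bounded_ops_def PiE_def)

lemma ops_bound: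
  assumes "T \<in> ops U E F"
  obtains B where "B > 0" "\<And>x. x \<in> E \<Longrightarrow> norm (T x) \<le> B * norm x"
proof -
  obtain B where B: "\<forall>x\<in>E. norm (T x) \<le> B * norm x"
    using assms by (auto simp: ops_def bounded_ops_def)
  have "norm (T x) \<le> (\<bar>B\<bar> + 1) * norm x" if "x \<in> E" for x
  proof -
    have "norm (T x) \<le> B * norm x" using B that by blast
    also have "\<dots> \<le> (\<bar>B\<bar> + 1) * norm x" by (intro mult_right_mono) auto
    finally show ?thesis .
  qed
  then show ?thesis using that[of "\<bar>B\<bar> + 1"] by simp
qed

lemma ops_scaleR: "T \<in> ops U E F \<Longrightarrow> x \<in> E \<Longrightarrow> T (r *\<^sub>R x) = r *\<^sub>R T x"
  using ops_scal[of T E F x "of_real r"] by (simp add: scal_of_real)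

lemma ops_diff:
  assumes "T \<in> ops U E F" "E \<in> spaces U" "x \<in> E" "y \<in> E"
  shows "T (x - y) = T x - T y"
  using ops_add[OF assms(1) _ assms(4), of "x - y"] subspace_diff[OF real_subspace[OF assms(2)] assms(3,4)] by simp

lemma op_norm_le:
  assumes "E \<in> spaces U" "B \<ge> 0" "\<And>x. x \<in> E \<Longrightarrow> norm (f x) \<le> B * norm x"
  shows "op_norm E f \<le> B"
  unfolding op_norm_def
proof (rule cSUP_least)
  show "E \<noteq> {}" using subspace_0[OF real_subspace[OF assms(1)]] by auto
  show "norm (f x) / norm x \<le> B" if "x \<in> E" for x
    using assms(2) assms(3)[OF that] by (cases "x = 0") (auto simp: field_simps)
qed

lemma op_norm_bound:
  assumes E: "E \<in> spaces U" and f: "f \<in> functionals U E" and x: "x \<in> E"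
  shows "norm (f x) \<le> op_norm E f * norm x"
proof -
  obtain B where B: "\<forall>x\<in>E. norm (f x) \<le> B * norm x" using functionals_bound[OF f] by blast
  have "bdd_above ((\<lambda>x. norm (f x) / norm x) ` E)"
  proof (rule bdd_aboveI2[where M="\<bar>B\<bar>"])
    fix x assume "x \<in> E"
    then have "norm (f x) \<le> B * norm x" using B by blast
    also have "\<dots> \<le> \<bar>B\<bar> * norm x" by (intro mult_right_mono) auto
    finally show "norm (f x) / norm x \<le> \<bar>B\<bar>" by (cases "x = 0") (auto simp: field_simps)
  qed
  then have "norm (f x) / norm x \<le> op_norm E f" unfolding op_norm_def using x by (intro cSUP_upper)
  moreover have "f 0 = 0" using functionals_scal[OF f x, of 0] by simp
  ultimately show ?thesis by (cases "x = 0") (auto simp: field_simps)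
qed

lemma inj_on_code:
  assumes E: "E \<in> spaces U"
  shows "inj_on (code U E) (functionals U E)"
proof (rule inj_onI)
  fix f g assume f: "f \<in> functionals U E" and g: "g \<in> functionals U E" and eq: "code U E f = code U E g"
  obtain B where B: "\<forall>x\<in>E. norm (g x) \<le> B * norm x" using functionals_bound[OF g] by blast
  have m: "(\<lambda>x\<in>E. (- 1) * g x) \<in> functionals U E"
    by (rule functionalsI[OF E, where B=B]) (use B functionals_add[OF g] functionals_scal[OF g] in auto)
  obtain A where A: "\<forall>x\<in>E. norm (f x) \<le> A * norm x" using functionals_bound[OF f] by blast
  have d: "(\<lambda>x\<in>E. f x + (\<lambda>x\<in>E. (- 1) * g x) x) \<in> functionals U E"
  proof (rule functionalsI[OF E, where B="A + B"])
    fix x assume x: "x \<in> E"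
    have "norm (f x + (\<lambda>x\<in>E. (- 1) * g x) x) \<le> norm (f x) + norm (g x)"
      using x norm_triangle_ineq4 by auto
    also have "\<dots> \<le> (A + B) * norm x" using A B x by (auto simp: distrib_right intro: add_mono)
    finally show "norm (f x + (\<lambda>x\<in>E. (- 1) * g x) x) \<le> (A + B) * norm x" .
  qed (use functionals_add[OF f] functionals_scal[OF f] functionals_add[OF m] functionals_scal[OF m]
       in \<open>simp_all add: distrib_left algebra_simps del: restrict_apply\<close>)
  have "code U E (\<lambda>x\<in>E. f x + (\<lambda>x\<in>E. (- 1) * g x) x) = 0"
    by (simp only: code_add[OF E f m] code_scal[OF E g] eq) (simp add: vs.scale_minus_left)
  then have "op_norm E (\<lambda>x\<in>E. f x + (\<lambda>x\<in>E. (- 1) * g x) x) = 0" using norm_code[OF E d] by simp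
  then have "f x = g x" if "x \<in> E" for x using op_norm_bound[OF E d that] that by simp
  then show "f = g" by (rule extensionalityI[OF functionals_ext[OF f] functionals_ext[OF g]])
qed

lemma as_functional_mem: "E \<in> spaces U \<Longrightarrow> \<phi> \<in> dual U E \<Longrightarrow> as_functional U E \<phi> \<in> functionals U E"
  unfolding as_functional_def dual_def by (rule the_inv_into_into[OF inj_on_code]) auto

lemma code_as_functional: "E \<in> spaces U \<Longrightarrow> \<phi> \<in> dual U E \<Longrightarrow> code U E (as_functional U E \<phi>) = \<phi>"
  unfolding as_functional_def dual_def by (rule f_the_inv_into_f[OF inj_on_code])

lemma as_functional_code: "E \<in> spaces U \<Longrightarrow> f \<in> functionals U E \<Longrightarrow> as_functional U E (code U E f) = f"
  unfolding as_functional_def by (rule the_inv_into_f_f[OF inj_on_code])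

text \<open>
  The value of an element \<open>\<phi>\<close> of \<open>dual U E\<close> at \<open>x \<in> E\<close>. The lemmas below on \<open>pairing\<close> replace the
  coding of functionals by vectors in all that follows.
\<close>

abbreviation pairing :: "'v set \<Rightarrow> 'v \<Rightarrow> 'v \<Rightarrow> 'k" where
  "pairing E \<phi> x \<equiv> as_functional U E \<phi> x"

lemma code_represents:
  assumes E: "E \<in> spaces U"
    and "\<And>x y. x \<in> E \<Longrightarrow> y \<in> E \<Longrightarrow> h (x + y) = h x + h y"
    and "\<And>c x. x \<in> E \<Longrightarrow> h (scal U c x) = c * h x"
    and "\<And>x. x \<in> E \<Longrightarrow> norm (h x) \<le> B * norm x"
  shows "code U E (restrict h E) \<in> dual U E" "x \<in> E \<Longrightarrow> pairing E (code U E (restrict h E)) x = h x"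
proof -
  have "restrict h E \<in> functionals U E" by (rule functionalsI[OF E, where B=B]) (use assms in auto)
  then show "code U E (restrict h E) \<in> dual U E" "x \<in> E \<Longrightarrow> pairing E (code U E (restrict h E)) x = h x"
    by (auto simp: dual_def as_functional_code[OF E])
qed

lemma pairing_add_right:
  "E \<in> spaces U \<Longrightarrow> \<phi> \<in> dual U E \<Longrightarrow> x \<in> E \<Longrightarrow> y \<in> E \<Longrightarrow> pairing E \<phi> (x + y) = pairing E \<phi> x + pairing E \<phi> y"
  by (rule functionals_add[OF as_functional_mem])

lemma pairing_scal_right:
  "E \<in> spaces U \<Longrightarrow> \<phi> \<in> dual U E \<Longrightarrow> x \<in> E \<Longrightarrow> pairing E \<phi> (scal U c x) = c * pairing E \<phi> x"
  by (rule functionals_scal[OF as_functional_mem])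

lemma norm_pairing_le:
  "E \<in> spaces U \<Longrightarrow> \<phi> \<in> dual U E \<Longrightarrow> x \<in> E \<Longrightarrow> norm (pairing E \<phi> x) \<le> norm \<phi> * norm x"
  using op_norm_bound[OF _ as_functional_mem] norm_code[OF _ as_functional_mem] by (simp add: code_as_functional)

lemma norm_dual_le:
  assumes "E \<in> spaces U" "\<phi> \<in> dual U E" "B \<ge> 0" "\<And>x. x \<in> E \<Longrightarrow> norm (pairing E \<phi> x) \<le> B * norm x"
  shows "norm \<phi> \<le> B"
  using op_norm_le[OF assms(1,3,4)] norm_code[OF assms(1) as_functional_mem[OF assms(1,2)]]
  by (simp add: code_as_functional assms)

lemma dual_eqI:
  assumes E: "E \<in> spaces U" and \<phi>: "\<phi> \<in> dual U E" and \<psi>: "\<psi> \<in> dual U E"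
    and eq: "\<And>x. x \<in> E \<Longrightarrow> pairing E \<phi> x = pairing E \<psi> x"
  shows "\<phi> = \<psi>"
proof -
  have "as_functional U E \<phi> = as_functional U E \<psi>"
    using eq by (rule extensionalityI[OF functionals_ext[OF as_functional_mem[OF E \<phi>]] functionals_ext[OF as_functional_mem[OF E \<psi>]]])
  then show ?thesis by (metis E \<phi> \<psi> code_as_functional)
qed

lemma pairing_add_left:
  assumes E: "E \<in> spaces U" and \<phi>: "\<phi> \<in> dual U E" and \<psi>: "\<psi> \<in> dual U E" and x: "x \<in> E"
  shows "pairing E (\<phi> + \<psi>) x = pairing E \<phi> x + pairing E \<psi> x"
proof -
  note f = as_functional_mem[OF E \<phi>] and g = as_functional_mem[OF E \<psi>]
  have "pairing E (code U E (\<lambda>x\<in>E. pairing E \<phi> x + pairing E \<psi> x)) x = pairing E \<phi> x + pairing E \<psi> x"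
  proof (rule code_represents(2)[OF E _ _ _ x, where B="norm \<phi> + norm \<psi>"])
    fix x assume x: "x \<in> E"
    show "norm (pairing E \<phi> x + pairing E \<psi> x) \<le> (norm \<phi> + norm \<psi>) * norm x"
      using norm_pairing_le[OF E \<phi> x] norm_pairing_le[OF E \<psi> x]
      by (intro norm_triangle_le) (simp add: distrib_right)
  qed (auto simp: functionals_add[OF f] functionals_add[OF g] functionals_scal[OF f] functionals_scal[OF g] distrib_left)
  then show ?thesis by (simp add: code_add[OF E f g] code_as_functional[OF E \<phi>] code_as_functional[OF E \<psi>])
qed

lemma pairing_scal_left:
  assumes E: "E \<in> spaces U" and \<phi>: "\<phi> \<in> dual U E" and x: "x \<in> E"
  shows "pairing E (scal U c \<phi>) x = c * pairing E \<phi> x"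
proof -
  note f = as_functional_mem[OF E \<phi>]
  have "pairing E (code U E (\<lambda>x\<in>E. c * pairing E \<phi> x)) x = c * pairing E \<phi> x"
  proof (rule code_represents(2)[OF E _ _ _ x, where B="norm c * norm \<phi>"])
    fix x assume x: "x \<in> E"
    show "norm (c * pairing E \<phi> x) \<le> norm c * norm \<phi> * norm x"
      using norm_pairing_le[OF E \<phi> x] by (simp add: norm_mult mult.assoc mult_left_mono)
  qed (auto simp: functionals_add[OF f] functionals_scal[OF f] distrib_left)
  then show ?thesis by (simp add: code_scal[OF E f] code_as_functional[OF E \<phi>])
qed

lemma pairing_diff_left:
  assumes "E \<in> spaces U" "\<phi> \<in> dual U E" "\<psi> \<in> dual U E" "x \<in> E"
  shows "pairing E (\<phi> - \<psi>) x = pairing E \<phi> x - pairing E \<psi> x"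
  using pairing_add_left[of E "\<phi> - \<psi>" \<psi> x] assms subspace_diff[OF real_subspace[OF dual_in_spaces]] by simp

lemma pairing_diff_right:
  assumes "E \<in> spaces U" "\<phi> \<in> dual U E" "x \<in> E" "y \<in> E"
  shows "pairing E \<phi> (x - y) = pairing E \<phi> x - pairing E \<phi> y"
  using pairing_add_right[of E \<phi> "x - y" y] assms subspace_diff[OF real_subspace] by simp

text \<open>
  A real-linear functional \<open>g\<close> is dominated by a scalar-linear one. Over the complex numbers it is
  the functional \<open>g x - i g (i x)\<close>, whose real part is \<open>g\<close>; a sharp norm bound is not needed.
\<close>

lemma scalar_extension:
  assumes E: "E \<in> spaces U" and g: "bounded_linear g"
  shows "\<exists>\<phi>\<in>dual U E. norm \<phi> \<le> 2 * onorm g \<and> (\<forall>x\<in>E. \<bar>g x\<bar> \<le> norm (pairing E \<phi> x))"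
proof -
  note lin = bounded_linear.linear[OF g]
  have on: "onorm g \<ge> 0" by (rule onorm_pos_le[OF g])
  have bound: "\<bar>g x\<bar> \<le> onorm g * norm x" for x using onorm[OF g, of x] by simp
  have "\<exists>h. (\<forall>x y. h (x + y) = h x + h y) \<and> (\<forall>c x. h (scal U c x) = c * h x) \<and>
      (\<forall>x. norm (h x) \<le> 2 * onorm g * norm x) \<and> (\<forall>x. \<bar>g x\<bar> \<le> norm (h x))"
    using scalar_field_cases[where 'k='k]
  proof
    assume real: "\<forall>c::'k. \<exists>r. c = of_real r"
    have "of_real (g (scal U c x)) = c * of_real (g x)" for c x
    proof -
      obtain r where "c = of_real r" using real by blast
      then show ?thesis by (simp add: scal_of_real linear_scale[OF lin])
    qed
    moreover have "\<bar>g x\<bar> \<le> 2 * onorm g * norm x" for x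
      using bound[of x] mult_nonneg_nonneg[OF on norm_ge_zero[of x]] by simp
    ultimately show ?thesis by (intro exI[of _ "\<lambda>x. of_real (g x)"]) (auto simp: linear_add[OF lin])
  next
    assume "\<exists>i::'k. i * i = - 1 \<and> norm i = 1 \<and> (\<forall>c. \<exists>a b. c = of_real a + of_real b * i) \<and>
      (\<forall>a b. \<bar>a\<bar> \<le> norm (of_real a - of_real b * i))"
    then obtain i :: 'k where i: "i * i = - 1" "norm i = 1" "\<And>c. \<exists>a b. c = of_real a + of_real b * i"
      "\<And>a b. \<bar>a\<bar> \<le> norm (of_real a - of_real b * i)" by blast
    define h where "h x = of_real (g x) - of_real (g (scal U i x)) * i" for x
    have add: "h (x + y) = h x + h y" for x y
      by (simp add: h_def vs.scale_right_distrib linear_add[OF lin] algebra_simps)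
    have hr: "h (r *\<^sub>R x) = of_real r * h x" for r x
    proof -
      have "scal U i (r *\<^sub>R x) = r *\<^sub>R scal U i x" by (simp add: mult.commute flip: scal_of_real)
      then show ?thesis by (simp add: h_def linear_scale[OF lin] algebra_simps)
    qed
    have hi: "h (scal U i x) = i * h x" for x
    proof -
      have "scal U i (scal U i x) = - x" by (simp add: i)
      then have "h (scal U i x) = of_real (g (scal U i x)) + of_real (g x) * i"
        by (simp add: h_def linear_neg[OF lin])
      moreover have "i * h x = of_real (g x) * i - of_real (g (scal U i x)) * (i * i)"
        by (simp add: h_def algebra_simps)
      ultimately show ?thesis by (simp add: i(1))
    qed
    have scal: "h (scal U c x) = c * h x" for c x
    proof -
      obtain a b where c: "c = of_real a + of_real b * i" using i(3) by blast
      have "scal U c x = a *\<^sub>R x + b *\<^sub>R scal U i x"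
        by (simp add: c vs.scale_left_distrib flip: scal_of_real)
      then show ?thesis by (simp add: add hr hi c algebra_simps)
    qed
    have "norm (h x) \<le> 2 * onorm g * norm x" for x
    proof -
      have "norm (h x) \<le> \<bar>g x\<bar> + \<bar>g (scal U i x)\<bar>"
        unfolding h_def by (rule order_trans[OF norm_triangle_ineq4]) (simp add: norm_mult i)
      then show ?thesis using bound[of x] bound[of "scal U i x"] by (simp add: norm_scal i)
    qed
    moreover have "\<bar>g x\<bar> \<le> norm (h x)" for x unfolding h_def by (rule i(4))
    ultimately show ?thesis using add scal by blast
  qed
  then obtain h where h: "\<And>x y. h (x + y) = h x + h y" "\<And>c x. h (scal U c x) = c * h x"
      "\<And>x. norm (h x) \<le> 2 * onorm g * norm x" "\<And>x. \<bar>g x\<bar> \<le> norm (h x)" by blast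
  note rep = code_represents[OF E h(1,2,3)]
  show ?thesis
  proof (intro bexI[OF _ rep(1)] conjI ballI)
    show "norm (code U E (restrict h E)) \<le> 2 * onorm g"
      by (rule norm_dual_le[OF E rep(1)]) (use on rep(2) h(3) in auto)
    show "\<bar>g x\<bar> \<le> norm (pairing E (code U E (restrict h E)) x)" if "x \<in> E" for x
      using h(4)[of x] rep(2)[OF that] by simp
  qed
qed

section \<open>Adjoints and the bidual\<close>

lemma ops_id: "E \<in> spaces U \<Longrightarrow> (\<lambda>x\<in>E. x) \<in> ops U E E"
  by (rule opsI[where B=1]) auto

lemma ops_compose:
  assumes "E \<in> spaces U" and T: "T \<in> ops U E F" and S: "S \<in> ops U F G"
  shows "compose E S T \<in> ops U E G"
proof -
  obtain A where A: "A > 0" "\<And>x. x \<in> E \<Longrightarrow> norm (T x) \<le> A * norm x" using ops_bound[OF T] by blast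
  obtain B where B: "B > 0" "\<And>x. x \<in> F \<Longrightarrow> norm (S x) \<le> B * norm x" using ops_bound[OF S] by blast
  have bd: "norm (S (T x)) \<le> (B * A) * norm x" if "x \<in> E" for x
  proof -
    have "norm (S (T x)) \<le> B * norm (T x)" using B(2) ops_mem[OF T that] by blast
    also have "\<dots> \<le> B * (A * norm x)" using A(2)[OF that] B(1) by simp
    finally show ?thesis by (simp add: mult.assoc)
  qed
  show ?thesis
    unfolding compose_def
    by (rule opsI[OF assms(1), where B="B * A"])
      (use bd in \<open>simp_all add: ops_mem[OF T] ops_mem[OF S] ops_add[OF T] ops_add[OF S] ops_scal[OF T] ops_scal[OF S]\<close>)
qed

lemma
  assumes E: "E \<in> spaces U" and F: "F \<in> spaces U" and S: "S \<in> ops U E F"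
  shows adjoint_in_ops: "adjoint_op U E F S \<in> ops U (dual U F) (dual U E)"
    and pairing_adjoint: "\<phi> \<in> dual U F \<Longrightarrow> x \<in> E \<Longrightarrow> pairing E (adjoint_op U E F S \<phi>) x = pairing F \<phi> (S x)"
proof -
  define A where "A \<phi> = code U E (\<lambda>x\<in>E. pairing F \<phi> (S x))" for \<phi>
  obtain B where B: "B > 0" "\<And>x. x \<in> E \<Longrightarrow> norm (S x) \<le> B * norm x" using ops_bound[OF S] by blast
  have bd: "norm (pairing F \<phi> (S x)) \<le> (B * norm \<phi>) * norm x" if "x \<in> E" "\<phi> \<in> dual U F" for x \<phi>
  proof -
    have "norm (pairing F \<phi> (S x)) \<le> norm \<phi> * norm (S x)" by (rule norm_pairing_le[OF F that(2) ops_mem[OF S that(1)]])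
    also have "\<dots> \<le> norm \<phi> * (B * norm x)" using B(2)[OF that(1)] by (intro mult_left_mono) auto
    finally show ?thesis by (simp add: ac_simps)
  qed
  have rep: "A \<phi> \<in> dual U E" "\<And>x. x \<in> E \<Longrightarrow> pairing E (A \<phi>) x = pairing F \<phi> (S x)" if \<phi>: "\<phi> \<in> dual U F" for \<phi>
    unfolding A_def
    by (rule code_represents[OF E, where B="B * norm \<phi>"];
      simp add: bd \<phi> ops_add[OF S] ops_scal[OF S] ops_mem[OF S] pairing_add_right[OF F \<phi>] pairing_scal_right[OF F \<phi>])+
  have F': "dual U F \<in> spaces U" and E': "dual U E \<in> spaces U" using E F dual_in_spaces by auto
  note F'add = subspace_add[OF real_subspace[OF F']] and F'scal = space_scal[OF F']
  note E'add = subspace_add[OF real_subspace[OF E']] and E'scal = space_scal[OF E']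
  have eq: "adjoint_op U E F S = restrict A (dual U F)"
    by (simp add: adjoint_op_def A_def compose_def restrict_def fun_eq_iff)
  show "adjoint_op U E F S \<in> ops U (dual U F) (dual U E)"
    unfolding eq
  proof (rule opsI[OF F', where B=B])
    fix \<phi> assume \<phi>: "\<phi> \<in> dual U F"
    show "A \<phi> \<in> dual U E" by (rule rep(1)[OF \<phi>])
    show "norm (A \<phi>) \<le> B * norm \<phi>"
      by (rule norm_dual_le[OF E rep(1)[OF \<phi>]]) (use B(1) bd \<phi> rep in auto)
    show "A (scal U c \<phi>) = scal U c (A \<phi>)" for c
      by (rule dual_eqI[OF E])
        (simp_all add: rep \<phi> F'scal E'scal pairing_scal_left[OF E] pairing_scal_left[OF F] ops_mem[OF S])
    fix \<psi> assume \<psi>: "\<psi> \<in> dual U F"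
    show "A (\<phi> + \<psi>) = A \<phi> + A \<psi>"
      by (rule dual_eqI[OF E])
        (simp_all add: rep \<phi> \<psi> F'add E'add pairing_add_left[OF E] pairing_add_left[OF F] ops_mem[OF S])
  qed
  show "\<phi> \<in> dual U F \<Longrightarrow> x \<in> E \<Longrightarrow> pairing E (adjoint_op U E F S \<phi>) x = pairing F \<phi> (S x)"
    by (simp add: eq rep)
qed

lemma
  assumes E: "E \<in> spaces U"
  shows embedding_in_ops: "bidual_embedding U E \<in> ops U E (dual U (dual U E))"
    and pairing_embedding: "x \<in> E \<Longrightarrow> \<phi> \<in> dual U E \<Longrightarrow>
      pairing (dual U E) (bidual_embedding U E x) \<phi> = pairing E \<phi> x"
    and norm_embedding_le: "x \<in> E \<Longrightarrow> norm (bidual_embedding U E x) \<le> norm x"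
proof -
  have E': "dual U E \<in> spaces U" and E'': "dual U (dual U E) \<in> spaces U" using E dual_in_spaces by auto
  define J where "J x = code U (dual U E) (\<lambda>\<phi>\<in>dual U E. pairing E \<phi> x)" for x
  have rep: "J x \<in> dual U (dual U E)" "\<And>\<phi>. \<phi> \<in> dual U E \<Longrightarrow> pairing (dual U E) (J x) \<phi> = pairing E \<phi> x"
    if x: "x \<in> E" for x
    unfolding J_def
    by (rule code_represents[OF E', where B="norm x"];
      use norm_pairing_le[OF E _ x] in \<open>simp add: x pairing_add_left[OF E] pairing_scal_left[OF E] mult.commute\<close>)+
  have eq: "bidual_embedding U E = restrict J E"
    by (simp add: bidual_embedding_def J_def restrict_def fun_eq_iff)
  have norm: "norm (J x) \<le> norm x" if x: "x \<in> E" for x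
    by (rule norm_dual_le[OF E' rep(1)[OF x]]) (use norm_pairing_le[OF E _ x] rep[OF x] in \<open>auto simp: mult.commute\<close>)
  note cl = subspace_add[OF real_subspace[OF E]] subspace_add[OF real_subspace[OF E'']] space_scal[OF E] space_scal[OF E'']
  show "bidual_embedding U E \<in> ops U E (dual U (dual U E))"
    unfolding eq
  proof (rule opsI[OF E, where B=1])
    fix x assume x: "x \<in> E"
    show "J x \<in> dual U (dual U E)" "norm (J x) \<le> 1 * norm x" using rep norm x by auto
    show "J (scal U c x) = scal U c (J x)" for c
      by (rule dual_eqI[OF E']) (simp_all add: rep x cl pairing_scal_right[OF E] pairing_scal_left[OF E'])
    fix y assume y: "y \<in> E"
    show "J (x + y) = J x + J y"
      by (rule dual_eqI[OF E']) (simp_all add: rep x y cl pairing_add_right[OF E] pairing_add_left[OF E'])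
  qed
  show "x \<in> E \<Longrightarrow> \<phi> \<in> dual U E \<Longrightarrow> pairing (dual U E) (bidual_embedding U E x) \<phi> = pairing E \<phi> x"
    by (simp add: eq rep)
  show "x \<in> E \<Longrightarrow> norm (bidual_embedding U E x) \<le> norm x" by (simp add: eq norm)
qed

lemma norm_le_embedding:
  assumes E: "E \<in> spaces U" and x: "x \<in> E"
  shows "norm x \<le> 2 * norm (bidual_embedding U E x)"
proof -
  obtain g where g: "bounded_linear g" "\<And>x. \<bar>g x\<bar> \<le> norm x" "g x = norm x"
    using norming_real_functional[of x] by blast
  have "onorm g \<le> 1" by (rule onorm_bound) (use g in auto)
  obtain \<phi> where \<phi>: "\<phi> \<in> dual U E" "norm \<phi> \<le> 2 * onorm g" "\<And>x. x \<in> E \<Longrightarrow> \<bar>g x\<bar> \<le> norm (pairing E \<phi> x)"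
    using scalar_extension[OF E g(1)] by blast
  have J: "bidual_embedding U E x \<in> dual U (dual U E)" by (rule ops_mem[OF embedding_in_ops[OF E] x])
  have "norm x \<le> norm (pairing E \<phi> x)" using \<phi>(3)[OF x] g(3) by simp
  also have "\<dots> = norm (pairing (dual U E) (bidual_embedding U E x) \<phi>)" by (simp add: pairing_embedding[OF E x \<phi>(1)])
  also have "\<dots> \<le> norm (bidual_embedding U E x) * norm \<phi>" by (rule norm_pairing_le[OF dual_in_spaces[OF E] J \<phi>(1)])
  also have "\<dots> \<le> norm (bidual_embedding U E x) * 2" using \<phi>(2) \<open>onorm g \<le> 1\<close> by (intro mult_left_mono) auto
  finally show ?thesis by simp
qed

text \<open>
  The embedding into the bidual is bounded below, so for reflexive \<open>E\<close> its inverse is bounded.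
\<close>

lemma reflexive_inverse:
  assumes E: "E \<in> spaces U" and refl: "reflexive U E"
  shows "\<exists>K \<in> ops U (dual U (dual U E)) E. (\<forall>x\<in>E. K (bidual_embedding U E x) = x) \<and>
    (\<forall>z\<in>dual U (dual U E). bidual_embedding U E (K z) = z)"
proof -
  let ?J = "bidual_embedding U E" and ?E'' = "dual U (dual U E)"
  have E'': "?E'' \<in> spaces U" using E dual_in_spaces by auto
  note J = embedding_in_ops[OF E]
  have inj: "inj_on ?J E"
  proof (rule inj_onI)
    fix x y assume xy: "x \<in> E" "y \<in> E" "?J x = ?J y"
    have "norm (x - y) \<le> 2 * norm (?J (x - y))"
      by (rule norm_le_embedding[OF E subspace_diff[OF real_subspace[OF E] xy(1,2)]])
    then show "x = y" using ops_diff[OF J E xy(1,2)] xy(3) by simp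
  qed
  have img: "?J ` E = ?E''" using refl by (simp add: reflexive_def)
  define k where "k = inv_into E ?J"
  have kJ: "k (?J x) = x" if "x \<in> E" for x unfolding k_def using inj that by simp
  have Jk: "?J (k z) = z" "k z \<in> E" if "z \<in> ?E''" for z
    using f_inv_into_f[of z ?J E] inv_into_into[of z ?J E] that img by (auto simp: k_def)
  have "restrict k ?E'' \<in> ops U ?E'' E"
  proof (rule opsI[OF E'', where B=2])
    fix z assume z: "z \<in> ?E''"
    show "k z \<in> E" by (rule Jk(2)[OF z])
    show "norm (k z) \<le> 2 * norm z" using norm_le_embedding[OF E Jk(2)[OF z]] Jk(1)[OF z] by simp
    show "k (scal U c z) = scal U c (k z)" for c
      using kJ[OF space_scal[OF E Jk(2)[OF z]], of c] ops_scal[OF J Jk(2)[OF z], of c] Jk(1)[OF z] by simp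
    fix w assume w: "w \<in> ?E''"
    show "k (z + w) = k z + k w"
      using kJ[OF subspace_add[OF real_subspace[OF E] Jk(2)[OF z] Jk(2)[OF w]]]
        ops_add[OF J Jk(2)[OF z] Jk(2)[OF w]] Jk(1)[OF z] Jk(1)[OF w] by simp
  qed
  then show ?thesis
  proof (intro bexI conjI ballI)
    show "restrict k ?E'' (?J x) = x" if "x \<in> E" for x using kJ[OF that] ops_mem[OF J that] by simp
    show "?J (restrict k ?E'' z) = z" if "z \<in> ?E''" for z using Jk(1)[OF that] that by simp
  qed
qed

text \<open>
  The embedding into the bidual is a natural transformation: \<open>S'' J = J S\<close>.
\<close>

lemma biadjoint_embedding:
  assumes E: "E \<in> spaces U" and F: "F \<in> spaces U" and S: "S \<in> ops U E F" and x: "x \<in> E"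
  shows "adjoint_op U (dual U F) (dual U E) (adjoint_op U E F S) (bidual_embedding U E x)
    = bidual_embedding U F (S x)"
proof (rule dual_eqI[OF dual_in_spaces[OF F]])
  have E': "dual U E \<in> spaces U" and F': "dual U F \<in> spaces U" using E F dual_in_spaces by auto
  note S' = adjoint_in_ops[OF E F S] and Jx = ops_mem[OF embedding_in_ops[OF E] x]
  show "adjoint_op U (dual U F) (dual U E) (adjoint_op U E F S) (bidual_embedding U E x) \<in> dual U (dual U F)"
    by (rule ops_mem[OF adjoint_in_ops[OF F' E' S'] Jx])
  show "bidual_embedding U F (S x) \<in> dual U (dual U F)"
    by (rule ops_mem[OF embedding_in_ops[OF F] ops_mem[OF S x]])
  fix \<phi> assume \<phi>: "\<phi> \<in> dual U F"
  show "pairing (dual U F) (adjoint_op U (dual U F) (dual U E) (adjoint_op U E F S) (bidual_embedding U E x)) \<phi>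
    = pairing (dual U F) (bidual_embedding U F (S x)) \<phi>"
    by (simp add: pairing_adjoint[OF F' E' S' Jx \<phi>] pairing_embedding[OF E x ops_mem[OF S' \<phi>]]
        pairing_adjoint[OF E F S \<phi> x] pairing_embedding[OF F ops_mem[OF S x] \<phi>])
qed

text \<open>
  An operator \<open>R\<close> on the dual of a reflexive space is the adjoint of \<open>J\<^sup>-\<^sup>1 R' J\<close>.
\<close>

lemma reflexive_adjoint_surj:
  assumes E: "E \<in> spaces U" and refl: "reflexive U E" and R: "R \<in> ops U (dual U E) (dual U E)"
  obtains S where "S \<in> ops U E E" "adjoint_op U E E S = R"
proof -
  have E': "dual U E \<in> spaces U" and E'': "dual U (dual U E) \<in> spaces U" using E dual_in_spaces by auto
  let ?J = "bidual_embedding U E" and ?R' = "adjoint_op U (dual U E) (dual U E) R"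
  obtain K where K: "K \<in> ops U (dual U (dual U E)) E"
    "\<And>z. z \<in> dual U (dual U E) \<Longrightarrow> ?J (K z) = z"
    using reflexive_inverse[OF E refl] by blast
  note J = embedding_in_ops[OF E] and R' = adjoint_in_ops[OF E' E' R]
  define S where "S = compose E K (compose E ?R' ?J)"
  have S: "S \<in> ops U E E" unfolding S_def by (intro ops_compose[OF E _ K(1)] ops_compose[OF E J R'])
  have "adjoint_op U E E S \<phi> = R \<phi>" if \<phi>: "\<phi> \<in> dual U E" for \<phi>
  proof (rule dual_eqI[OF E])
    fix x assume x: "x \<in> E"
    have JS: "?J (S x) = ?R' (?J x)" using x by (simp add: S_def compose_eq K(2) ops_mem[OF R'] ops_mem[OF J])
    have "pairing E (adjoint_op U E E S \<phi>) x = pairing (dual U E) (?J (S x)) \<phi>"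
      by (simp add: pairing_adjoint[OF E E S \<phi> x] pairing_embedding[OF E ops_mem[OF S x] \<phi>])
    also have "\<dots> = pairing E (R \<phi>) x"
      unfolding JS
      by (simp add: pairing_adjoint[OF E' E' R ops_mem[OF J x] \<phi>] pairing_embedding[OF E x ops_mem[OF R \<phi>]])
    finally show "pairing E (adjoint_op U E E S \<phi>) x = pairing E (R \<phi>) x" .
  qed (use ops_mem[OF adjoint_in_ops[OF E E S] \<phi>] ops_mem[OF R \<phi>] in auto)
  note eq = this
  show ?thesis
  proof (rule that[OF S])
    show "adjoint_op U E E S = R"
      by (rule extensionalityI[OF ops_ext[OF adjoint_in_ops[OF E E S]] ops_ext[OF R]]) (rule eq)
  qed
qed

lemma adjoint_add:
  assumes E: "E \<in> spaces U" and F: "F \<in> spaces U" and S: "S \<in> ops U E F" and T: "T \<in> ops U E F"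
    and ST: "(\<lambda>x\<in>E. S x + T x) \<in> ops U E F"
  shows "adjoint_op U E F (\<lambda>x\<in>E. S x + T x) = (\<lambda>\<phi>\<in>dual U F. adjoint_op U E F S \<phi> + adjoint_op U E F T \<phi>)"
proof (rule extensionalityI[OF ops_ext[OF adjoint_in_ops[OF E F ST]]])
  fix \<phi> assume \<phi>: "\<phi> \<in> dual U F"
  note mem = ops_mem[OF adjoint_in_ops[OF E F S] \<phi>] ops_mem[OF adjoint_in_ops[OF E F T] \<phi>]
  have "adjoint_op U E F (\<lambda>x\<in>E. S x + T x) \<phi> = adjoint_op U E F S \<phi> + adjoint_op U E F T \<phi>"
    by (rule dual_eqI[OF E ops_mem[OF adjoint_in_ops[OF E F ST] \<phi>]
          subspace_add[OF real_subspace[OF dual_in_spaces[OF E]] mem]])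
      (simp add: pairing_adjoint[OF E F ST \<phi>] pairing_adjoint[OF E F S \<phi>] pairing_adjoint[OF E F T \<phi>]
        pairing_add_left[OF E mem] pairing_add_right[OF F \<phi>] ops_mem[OF S] ops_mem[OF T])
  then show "adjoint_op U E F (\<lambda>x\<in>E. S x + T x) \<phi> = (\<lambda>\<phi>\<in>dual U F. adjoint_op U E F S \<phi> + adjoint_op U E F T \<phi>) \<phi>"
    using \<phi> by simp
qed auto

lemma adjoint_scal:
  assumes E: "E \<in> spaces U" and F: "F \<in> spaces U" and S: "S \<in> ops U E F"
    and cS: "(\<lambda>x\<in>E. scal U c (S x)) \<in> ops U E F"
  shows "adjoint_op U E F (\<lambda>x\<in>E. scal U c (S x)) = (\<lambda>\<phi>\<in>dual U F. scal U c (adjoint_op U E F S \<phi>))"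
proof (rule extensionalityI[OF ops_ext[OF adjoint_in_ops[OF E F cS]]])
  fix \<phi> assume \<phi>: "\<phi> \<in> dual U F"
  note mem = ops_mem[OF adjoint_in_ops[OF E F S] \<phi>]
  have "adjoint_op U E F (\<lambda>x\<in>E. scal U c (S x)) \<phi> = scal U c (adjoint_op U E F S \<phi>)"
    by (rule dual_eqI[OF E ops_mem[OF adjoint_in_ops[OF E F cS] \<phi>]
          space_scal[OF dual_in_spaces[OF E] mem]])
      (simp add: pairing_adjoint[OF E F cS \<phi>] pairing_adjoint[OF E F S \<phi>]
        pairing_scal_left[OF E mem] pairing_scal_right[OF F \<phi>] ops_mem[OF S])
  then show "adjoint_op U E F (\<lambda>x\<in>E. scal U c (S x)) \<phi> = (\<lambda>\<phi>\<in>dual U F. scal U c (adjoint_op U E F S \<phi>)) \<phi>"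
    using \<phi> by simp
qed auto

lemma ops_sum:
  assumes E: "E \<in> spaces U" and S: "S \<in> ops U E F" and T: "T \<in> ops U E F" and F: "F \<in> spaces U"
  shows "(\<lambda>x\<in>E. S x + T x) \<in> ops U E F"
proof -
  obtain A where A: "A > 0" "\<And>x. x \<in> E \<Longrightarrow> norm (S x) \<le> A * norm x" using ops_bound[OF S] by blast
  obtain B where B: "B > 0" "\<And>x. x \<in> E \<Longrightarrow> norm (T x) \<le> B * norm x" using ops_bound[OF T] by blast
  show ?thesis
  proof (rule opsI[OF E, where B="A + B"])
    fix x assume x: "x \<in> E"
    show "norm (S x + T x) \<le> (A + B) * norm x"
      using A(2)[OF x] B(2)[OF x] by (intro norm_triangle_le) (simp add: distrib_right)
  qed (auto simp: ops_add[OF S] ops_add[OF T] ops_scal[OF S] ops_scal[OF T] vs.scale_right_distrib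
       intro!: subspace_add[OF real_subspace[OF F]] ops_mem[OF S] ops_mem[OF T])
qed

lemma ops_scal_mult:
  assumes E: "E \<in> spaces U" and S: "S \<in> ops U E F" and F: "F \<in> spaces U"
  shows "(\<lambda>x\<in>E. scal U c (S x)) \<in> ops U E F"
proof -
  obtain A where A: "A > 0" "\<And>x. x \<in> E \<Longrightarrow> norm (S x) \<le> A * norm x" using ops_bound[OF S] by blast
  show ?thesis
  proof (rule opsI[OF E, where B="norm c * A"])
    fix x assume x: "x \<in> E"
    show "norm (scal U c (S x)) \<le> norm c * A * norm x"
      using A(2)[OF x] by (simp add: norm_scal mult.assoc mult_left_mono)
  qed (auto simp: ops_add[OF S] ops_scal[OF S] vs.scale_right_distrib mult.commute
       intro!: space_scal[OF F] ops_mem[OF S])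
qed

section \<open>From approximation on the dual to approximation on the space\<close>

text \<open>
  If the adjoints of the operators in the linear space \<open>\<S>\<close> approximate the identity of the dual
  uniformly on null sequences, then \<open>\<S>\<close> approximates the identity uniformly on compact sets. No
  reflexivity is involved. Closure of \<open>\<S>\<close> under sums and real scalars suffices, as the separation takes
  place over the reals.
\<close>

lemma uniform_approximation:
  assumes X: "X \<in> spaces U" and SS: "\<S> \<subseteq> ops U X X"
    and add: "\<And>S T. S \<in> \<S> \<Longrightarrow> T \<in> \<S> \<Longrightarrow> (\<lambda>x\<in>X. S x + T x) \<in> \<S>"
    and scale: "\<And>r S. S \<in> \<S> \<Longrightarrow> (\<lambda>x\<in>X. scal U (of_real r) (S x)) \<in> \<S>"
    and dual_approx: "\<And>\<psi> e. range \<psi> \<subseteq> dual U X \<Longrightarrow> \<psi> \<longlonglongrightarrow> 0 \<Longrightarrow> e > 0 \<Longrightarrow>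
      \<exists>S\<in>\<S>. \<forall>n. norm (adjoint_op U X X S (\<psi> n) - \<psi> n) < e"
    and C: "compact C" "C \<subseteq> X" and e: "e > 0"
  shows "\<exists>S\<in>\<S>. \<forall>x\<in>C. norm (S x - x) < e"
proof (rule ccontr)
  assume not: "\<not> ?thesis"
  have X': "dual U X \<in> spaces U" by (rule dual_in_spaces[OF X])
  note subX = real_subspace[OF X] and subX' = real_subspace[OF X']
  obtain y :: "nat \<Rightarrow> 'v" where y: "range y \<subseteq> X" "y \<longlonglongrightarrow> 0"
    and rep: "\<And>x. x \<in> C \<Longrightarrow> \<exists>i. (\<lambda>k. (1/2)^k *\<^sub>R y (i k)) sums x"
    using compact_null_sequence[OF C(1) subX C(2)] by blast
  have yX: "y n \<in> X" for n using y(1) by blast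
  define N where "N = (\<lambda>S n. S (y n)) ` \<S>"
  \<comment> \<open>A point of \<open>C\<close> is a combination of the \<open>y n\<close> with coefficients of sum 2, hence \<open>e/4\<close>
    on the \<open>y n\<close> yields \<open>e/2\<close> on \<open>C\<close>.\<close>
  have far: "\<exists>n. norm (S (y n) - y n) \<ge> e/4" if S: "S \<in> \<S>" for S
  proof (rule ccontr)
    assume "\<not> ?thesis"
    then have small: "norm (S (y n) - y n) < e/4" for n by (simp add: not_le)
    have So: "S \<in> ops U X X" using S SS by blast
    obtain B where B: "B > 0" "\<And>x. x \<in> X \<Longrightarrow> norm (S x) \<le> B * norm x" using ops_bound[OF So] by blast
    have "norm (S x - x) < e" if x: "x \<in> C" for x
    proof -
      have xX: "x \<in> X" using x C(2) by blast
      obtain i where "(\<lambda>k. (1/2)^k *\<^sub>R y (i k)) sums x" using rep[OF x] by blast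
      then have lim: "(\<lambda>m. \<Sum>k<m. (1/2)^k *\<^sub>R y (i k)) \<longlonglongrightarrow> x" by (simp add: sums_def)
      define p where "p m = (\<Sum>k<m. (1/2)^k *\<^sub>R y (i k))" for m
      have pX: "p m \<in> X" for m
        unfolding p_def by (intro subspace_sum[OF subX] subspace_scale[OF subX] yX)
      have Sp: "norm (S (p m) - p m) \<le> e/4 * (\<Sum>k<m. (1/2)^k)" for m
      proof (induction m)
        case 0
        have "S 0 = 0" using ops_scaleR[OF So xX, of 0] by simp
        then show ?case by (simp add: p_def)
      next
        case (Suc m)
        have p: "p (Suc m) = p m + (1/2)^m *\<^sub>R y (i m)" by (simp add: p_def)
        have "S (p (Suc m)) = S (p m) + (1/2)^m *\<^sub>R S (y (i m))"
          unfolding p ops_add[OF So pX subspace_scale[OF subX yX]] ops_scaleR[OF So yX] ..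
        then have eq: "S (p (Suc m)) - p (Suc m) = (S (p m) - p m) + (1/2)^m *\<^sub>R (S (y (i m)) - y (i m))"
          unfolding p by (simp only: scaleR_diff_right add_diff_add)
        have "norm (S (p (Suc m)) - p (Suc m)) \<le> norm (S (p m) - p m) + (1/2)^m * norm (S (y (i m)) - y (i m))"
          unfolding eq using norm_triangle_ineq[of "S (p m) - p m" "(1/2)^m *\<^sub>R (S (y (i m)) - y (i m))"] by simp
        also have "\<dots> \<le> e/4 * (\<Sum>k<m. (1/2)^k) + (1/2)^m * (e/4)"
          using Suc small[of "i m"] by (intro add_mono mult_left_mono) auto
        finally show ?case by (simp add: algebra_simps)
      qed
      have Sp': "norm (S (p m) - p m) \<le> e/2" for m
      proof -
        have "(\<Sum>k<m. (1/2)^k) = 2 - 2 * (1/2 :: real)^m" by (induction m) simp_all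
        then have "(\<Sum>k<m. (1/2)^k) \<le> (2::real)" by simp
        then have "e/4 * (\<Sum>k<m. (1/2)^k) \<le> e/4 * 2" using e by (intro mult_left_mono) auto
        then show ?thesis using Sp[of m] by simp
      qed
      have "(\<lambda>m. e/2 + (B + 1) * norm (p m - x)) \<longlonglongrightarrow> e/2 + (B + 1) * norm (x - x)"
        by (intro tendsto_intros) (use lim in \<open>simp add: p_def\<close>)
      moreover have "norm (S x - x) \<le> e/2 + (B + 1) * norm (p m - x)" for m
      proof -
        have "S x - x = (S (p m) - p m) - (S (p m - x) - (p m - x))"
          by (simp add: ops_diff[OF So X pX xX])
        then have "norm (S x - x) \<le> norm (S (p m) - p m) + norm (S (p m - x) - (p m - x))"
          by (simp only: norm_triangle_ineq4)
        also have "\<dots> \<le> e/2 + (norm (S (p m - x)) + norm (p m - x))"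
          using Sp'[of m] norm_triangle_ineq4 by (intro add_mono)
        also have "\<dots> \<le> e/2 + (B + 1) * norm (p m - x)"
          using B(2)[OF subspace_diff[OF subX pX xX], of m] by (simp add: distrib_right)
        finally show ?thesis .
      qed
      ultimately have "norm (S x - x) \<le> e/2 + (B + 1) * norm (x - x)"
        by (intro LIMSEQ_le_const) auto
      then show ?thesis using e by simp
    qed
    then show False using not S by blast
  qed
  have "\<exists>S\<in>\<S>. \<forall>n. norm (adjoint_op U X X S 0 - 0) < 1"
    using dual_approx[of "\<lambda>n. 0" 1] subspace_0[OF subX'] by (simp add: image_subset_iff)
  then obtain S0 where S0: "S0 \<in> \<S>" by blast
  have N0: "z \<longlonglongrightarrow> 0" if z: "z \<in> N" for z
  proof -
    obtain S where S: "S \<in> \<S>" "z = (\<lambda>n. S (y n))" using z unfolding N_def by blast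
    then have So: "S \<in> ops U X X" using SS by blast
    obtain B where B: "B > 0" "\<And>x. x \<in> X \<Longrightarrow> norm (S x) \<le> B * norm x" using ops_bound[OF So] by blast
    have "(\<lambda>n. B * norm (y n)) \<longlonglongrightarrow> B * 0" by (intro tendsto_intros tendsto_norm_zero y(2))
    then have "(\<lambda>n. B * norm (y n)) \<longlonglongrightarrow> 0" by simp
    moreover have "\<forall>\<^sub>F n in sequentially. norm (z n) \<le> B * norm (y n)"
      using B(2)[OF yX] by (simp add: S(2))
    ultimately show ?thesis by (rule Lim_null_comparison[rotated])
  qed
  have Nscale: "(\<lambda>n. c *\<^sub>R z n) \<in> N" if z: "z \<in> N" for c z
  proof -
    obtain S where S: "S \<in> \<S>" "z = (\<lambda>n. S (y n))" using z unfolding N_def by blast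
    have "(\<lambda>n. c *\<^sub>R z n) = (\<lambda>n. (\<lambda>x\<in>X. scal U (of_real c) (S x)) (y n))"
      by (simp add: S(2) yX scal_of_real)
    then show ?thesis using scale[OF S(1)] unfolding N_def by blast
  qed
  have "(\<lambda>n. S0 (y n)) \<in> N" using S0 unfolding N_def by blast
  from Nscale[OF this, of 0] have Nzero: "(\<lambda>n. 0) \<in> N" by simp
  have Nadd: "(\<lambda>n. z n + w n) \<in> N" if zw: "z \<in> N" "w \<in> N" for z w
  proof -
    obtain S T where S: "S \<in> \<S>" "z = (\<lambda>n. S (y n))" "T \<in> \<S>" "w = (\<lambda>n. T (y n))"
      using zw unfolding N_def by blast
    have "(\<lambda>n. z n + w n) = (\<lambda>n. (\<lambda>x\<in>X. S x + T x) (y n))" by (simp add: S(2,4) yX)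
    then show ?thesis using add[OF S(1,3)] unfolding N_def by blast
  qed
  have Nfar: "\<exists>n. norm (z n - y n) \<ge> e/4" if "z \<in> N" for z
    using that far unfolding N_def by blast
  have e4: "e/4 > 0" using e by simp
  obtain g :: "nat \<Rightarrow> 'v \<Rightarrow> real" and d :: real where g: "\<And>n. bounded_linear (g n)" "summable (\<lambda>n. onorm (g n))"
    and d: "d > 0" and gd: "\<And>z. z \<in> N \<Longrightarrow> (\<lambda>n. g n (y n - z n)) sums d"
    using c0_separation[OF y(2) N0 Nzero Nadd Nscale e4 Nfar] by blast
  have "\<forall>n. \<exists>\<phi>\<in>dual U X. norm \<phi> \<le> 2 * onorm (g n) \<and> (\<forall>x\<in>X. \<bar>g n x\<bar> \<le> norm (pairing X \<phi> x))"
    using scalar_extension[OF X g(1)] by simp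
  then obtain \<phi> where \<phi>: "\<And>n. \<phi> n \<in> dual U X" "\<And>n. norm (\<phi> n) \<le> 2 * onorm (g n)"
    "\<And>n x. x \<in> X \<Longrightarrow> \<bar>g n x\<bar> \<le> norm (pairing X (\<phi> n) x)" by metis
  have sum\<phi>: "summable (\<lambda>n. norm (\<phi> n))"
    by (rule summable_comparison_test'[where N=0, OF summable_mult[OF g(2), of 2]]) (use \<phi>(2) in simp)
  obtain a s :: "nat \<Rightarrow> real" where as: "summable a" "s \<longlonglongrightarrow> 0" "\<And>n. a n \<ge> 0" "\<And>n. s n \<ge> 0"
    "\<And>n. norm (\<phi> n) = a n * s n" 
    using summable_null_factor[of "\<lambda>n. norm (\<phi> n)", OF norm_ge_zero sum\<phi>] by blast
  \<comment> \<open>Where \<open>\<phi> n = 0\<close>, the division by zero makes \<open>\<psi> n = 0\<close>, as it should be.\<close>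
  define \<psi> where "\<psi> n = (s n / norm (\<phi> n)) *\<^sub>R \<phi> n" for n
  have \<psi>X: "\<psi> n \<in> dual U X" for n unfolding \<psi>_def by (intro subspace_scale[OF subX'] \<phi>(1))
  have \<phi>\<psi>: "\<phi> n = scal U (of_real (a n)) (\<psi> n)" for n
  proof (cases "\<phi> n = 0")
    case False
    have "scal U (of_real (a n)) (\<psi> n) = (a n * s n / norm (\<phi> n)) *\<^sub>R \<phi> n"
      by (simp add: \<psi>_def scal_of_real)
    also have "\<dots> = \<phi> n" unfolding as(5)[of n, symmetric] using False by simp
    finally show ?thesis by simp
  qed (simp add: \<psi>_def scal_of_real)
  have "norm (\<psi> n) \<le> s n" for n using as(4)[of n] by (simp add: \<psi>_def)
  then have \<psi>0: "\<psi> \<longlonglongrightarrow> 0" by (intro Lim_null_comparison[OF _ as(2)]) auto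
  obtain M where M: "M > 0" "\<And>n. norm (y n) \<le> M"
    using convergent_imp_bounded[OF y(2)] by (auto simp: bounded_pos)
  define A where "A = suminf a"
  have A: "A \<ge> 0" unfolding A_def using as by (intro suminf_nonneg)
  define \<delta> where "\<delta> = d / (M * A + 1)"
  have MA: "M * A + 1 > 0" using M A by (simp add: add_nonneg_pos)
  have \<delta>: "\<delta> > 0" using d MA by (simp add: \<delta>_def)
  obtain S where S: "S \<in> \<S>" "\<And>n. norm (adjoint_op U X X S (\<psi> n) - \<psi> n) < \<delta>"
    using dual_approx[OF _ \<psi>0 \<delta>] \<psi>X by blast
  have So: "S \<in> ops U X X" using S SS by blast
  have bound: "norm (g n (y n - S (y n))) \<le> a n * (\<delta> * M)" for n
  proof -
    have SyX: "S (y n) \<in> X" by (rule ops_mem[OF So yX])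
    have S'\<psi>: "adjoint_op U X X S (\<psi> n) \<in> dual U X" by (rule ops_mem[OF adjoint_in_ops[OF X X So] \<psi>X])
    have "norm (g n (y n - S (y n))) \<le> norm (pairing X (\<phi> n) (y n - S (y n)))"
      using \<phi>(3)[OF subspace_diff[OF subX yX SyX]] by simp
    also have "\<dots> = a n * norm (pairing X (\<psi> n) (y n) - pairing X (\<psi> n) (S (y n)))"
      unfolding \<phi>\<psi> pairing_scal_left[OF X \<psi>X subspace_diff[OF subX yX SyX]] pairing_diff_right[OF X \<psi>X yX SyX]
      by (simp add: norm_mult as(3))
    also have "pairing X (\<psi> n) (y n) - pairing X (\<psi> n) (S (y n)) = pairing X (\<psi> n - adjoint_op U X X S (\<psi> n)) (y n)"
      by (simp add: pairing_diff_left[OF X \<psi>X S'\<psi> yX] pairing_adjoint[OF X X So \<psi>X yX])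
    also have "norm \<dots> \<le> norm (\<psi> n - adjoint_op U X X S (\<psi> n)) * norm (y n)"
      by (rule norm_pairing_le[OF X subspace_diff[OF subX' \<psi>X S'\<psi>] yX])
    also have "\<dots> \<le> \<delta> * M"
      using S(2)[of n] M(2)[of n] \<delta> by (intro mult_mono) (auto simp: norm_minus_commute)
    finally show ?thesis using as(3)[of n] by (simp add: mult_left_mono)
  qed
  have "(\<lambda>n. S (y n)) \<in> N" using S(1) unfolding N_def by blast
  then have sums: "(\<lambda>n. g n (y n - S (y n))) sums d" by (rule gd)
  have sumsA: "(\<lambda>n. a n * (\<delta> * M)) sums (A * (\<delta> * M))"
    unfolding A_def by (intro sums_mult2 summable_sums as(1))
  have le: "g n (y n - S (y n)) \<le> a n * (\<delta> * M)" for n using bound[of n] by simp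
  have "d \<le> A * (\<delta> * M)" by (rule sums_le[OF le sums sumsA])
  also have "\<dots> = d * (M * A / (M * A + 1))" by (simp add: \<delta>_def)
  also have "\<dots> < d * 1"
  proof (rule mult_strict_left_mono[OF _ d])
    show "M * A / (M * A + 1) < 1" unfolding divide_less_eq_1_pos[OF MA] by simp
  qed
  finally show False by simp
qed

section \<open>Approximation properties\<close>

text \<open>
  The generating sets of \<open>tau_c\<close> are centred at arbitrary operators; this lemma provides
  neighbourhoods centred at the given \<open>T\<close>. The distance to another centre attains its maximum on a
  compact set, which leaves room for a small ball around \<open>T\<close>.
\<close>

lemma tau_c_basic_neighbourhood:
  assumes E: "E \<in> spaces U" and W: "openin (tau_c U E F) W" and T: "T \<in> W" "T \<in> ops U E F"
  shows "\<exists>C e. compact C \<and> C \<subseteq> E \<and> e > 0 \<and> {S \<in> ops U E F. \<forall>x\<in>C. norm (S x - T x) < e} \<subseteq> W"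
proof -
  have "generate_topology_on {{S \<in> ops U E F. \<forall>x\<in>C. norm (S x - T x) < \<epsilon>} | T C \<epsilon>.
          T \<in> ops U E F \<and> C \<subseteq> E \<and> compact C \<and> \<epsilon> > 0} W"
    using W unfolding tau_c_def openin_topology_generated_by_iff .
  then show ?thesis using T(1)
  proof induction
    case Empty
    then show ?case by simp
  next
    case (Int a b)
    from Int.IH(1) Int.prems obtain C e where C: "compact C" "C \<subseteq> E" "e > 0"
      "{S \<in> ops U E F. \<forall>x\<in>C. norm (S x - T x) < e} \<subseteq> a" by blast
    from Int.IH(2) Int.prems obtain D f where D: "compact D" "D \<subseteq> E" "f > 0"
      "{S \<in> ops U E F. \<forall>x\<in>D. norm (S x - T x) < f} \<subseteq> b" by blast
    have "{S \<in> ops U E F. \<forall>x\<in>C \<union> D. norm (S x - T x) < min e f} \<subseteq> a \<inter> b"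
      using C(4) D(4) by auto
    then show ?case using C D by (intro exI[of _ "C \<union> D"] exI[of _ "min e f"]) auto
  next
    case (UN K)
    then obtain k where k: "k \<in> K" "T \<in> k" by blast
    from UN.IH[OF k] show ?case using k(1) by blast
  next
    case (Basis s)
    then obtain T0 C e where s: "s = {S \<in> ops U E F. \<forall>x\<in>C. norm (S x - T0 x) < e}"
      "T0 \<in> ops U E F" "C \<subseteq> E" "compact C" "e > 0" by blast
    have cont: "continuous_on C R" if R: "R \<in> ops U E F" for R
    proof -
      obtain B where B: "B > 0" "\<And>x. x \<in> E \<Longrightarrow> norm (R x) \<le> B * norm x" using ops_bound[OF R] by blast
      have "dist (R x) (R y) \<le> B * dist x y" if "x \<in> C" "y \<in> C" for x y
        using that s(3) B(2)[OF subspace_diff[OF real_subspace[OF E]], of x y] ops_diff[OF R E, of x y]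
        by (auto simp: dist_norm)
      then have "B-lipschitz_on C R" using B(1) by (intro lipschitz_onI) auto
      then show ?thesis by (rule lipschitz_on_continuous_on)
    qed
    show ?case
    proof (cases "C = {}")
      case True
      then show ?thesis using s by (intro exI[of _ "{}"] exI[of _ 1]) auto
    next
      case False
      have "continuous_on C (\<lambda>x. norm (T x - T0 x))" by (intro continuous_intros cont T(2) s(2))
      then obtain m where m: "m \<in> C" "\<forall>x\<in>C. norm (T x - T0 x) \<le> norm (T m - T0 m)"
        using continuous_attains_sup[OF s(4) False] by blast
      define f where "f = e - norm (T m - T0 m)"
      have "f > 0" using Basis.prems m(1) by (simp add: f_def s(1))
      moreover have "{S \<in> ops U E F. \<forall>x\<in>C. norm (S x - T x) < f} \<subseteq> s"
        unfolding s(1)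
      proof (intro subsetI CollectI conjI ballI)
        fix S x assume S: "S \<in> {S \<in> ops U E F. \<forall>x\<in>C. norm (S x - T x) < f}" and x: "x \<in> C"
        have "norm (S x - T0 x) \<le> norm (S x - T x) + norm (T x - T0 x)"
          using norm_triangle_ineq[of "S x - T x" "T x - T0 x"] by simp
        moreover have "norm (S x - T x) < f" "norm (T x - T0 x) \<le> norm (T m - T0 m)" using S x m by auto
        ultimately show "norm (S x - T0 x) < e" by (simp add: f_def)
      qed auto
      ultimately show ?thesis using s by blast
    qed
  qed
qed

lemma ideal_subset_ops: "operator_ideal U I \<Longrightarrow> E \<in> spaces U \<Longrightarrow> F \<in> spaces U \<Longrightarrow> I E F \<subseteq> ops U E F"
  unfolding operator_ideal_def by blast

lemma ideal_compose:
  "operator_ideal U I \<Longrightarrow> E \<in> spaces U \<Longrightarrow> F \<in> spaces U \<Longrightarrow> G \<in> spaces U \<Longrightarrow> H \<in> spaces U \<Longrightarrow>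
    T \<in> ops U E F \<Longrightarrow> R \<in> I F G \<Longrightarrow> S \<in> ops U G H \<Longrightarrow> compose E S (compose E R T) \<in> I E H"
  unfolding operator_ideal_def by blast

lemma ideal_add:
  "operator_ideal U I \<Longrightarrow> E \<in> spaces U \<Longrightarrow> F \<in> spaces U \<Longrightarrow> S \<in> I E F \<Longrightarrow> T \<in> I E F \<Longrightarrow>
    (\<lambda>x\<in>E. S x + T x) \<in> I E F"
  unfolding operator_ideal_def by blast

lemma ideal_scal:
  "operator_ideal U I \<Longrightarrow> E \<in> spaces U \<Longrightarrow> F \<in> spaces U \<Longrightarrow> T \<in> I E F \<Longrightarrow>
    (\<lambda>x\<in>E. scal U c (T x)) \<in> I E F"
  unfolding operator_ideal_def by blast

text \<open>
  Only the identity has to be approximated: if \<open>S\<close> is close to the identity on a compact set, then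
  \<open>T S\<close> is close to \<open>T\<close> there and belongs to the ideal.
\<close>

lemma approximation_property_iff:
  assumes I: "operator_ideal U I" and E: "E \<in> spaces U"
  shows "approximation_property U I E \<longleftrightarrow>
    (\<forall>C e. compact C \<and> C \<subseteq> E \<and> e > 0 \<longrightarrow> (\<exists>S\<in>I E E. \<forall>x\<in>C. norm (S x - x) < e))"
proof
  assume ap: "approximation_property U I E"
  show "\<forall>C e. compact C \<and> C \<subseteq> E \<and> e > 0 \<longrightarrow> (\<exists>S\<in>I E E. \<forall>x\<in>C. norm (S x - x) < e)"
  proof (intro allI impI)
    fix C and e :: real assume C: "compact C \<and> C \<subseteq> E \<and> e > 0"
    define W where "W = {S \<in> ops U E E. \<forall>x\<in>C. norm (S x - (\<lambda>x\<in>E. x) x) < e}"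
    have "openin (tau_c U E E) W"
      unfolding tau_c_def W_def by (rule topology_generated_by_Basis) (use C ops_id[OF E] in blast)
    moreover have "(\<lambda>x\<in>E. x) \<in> W" using ops_id[OF E] C by (auto simp: W_def)
    moreover have "(\<lambda>x\<in>E. x) \<in> tau_c U E E closure_of I E E"
      using ap ops_id[OF E] by (simp add: approximation_property_def)
    ultimately obtain S where "S \<in> I E E" "S \<in> W" by (auto simp: in_closure_of)
    then show "\<exists>S\<in>I E E. \<forall>x\<in>C. norm (S x - x) < e" using C by (force simp: W_def)
  qed
next
  assume id: "\<forall>C e. compact C \<and> C \<subseteq> E \<and> e > 0 \<longrightarrow> (\<exists>S\<in>I E E. \<forall>x\<in>C. norm (S x - x) < e)"
  have top: "topspace (tau_c U E E) = ops U E E"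
  proof
    show "topspace (tau_c U E E) \<subseteq> ops U E E" unfolding tau_c_def topology_generated_by_topspace by blast
    have "openin (tau_c U E E) {S \<in> ops U E E. \<forall>x\<in>{}. norm (S x - (\<lambda>x\<in>E. x) x) < 1}"
      unfolding tau_c_def by (rule topology_generated_by_Basis) (use ops_id[OF E] in \<open>blast intro: zero_less_one compact_empty\<close>)
    then show "ops U E E \<subseteq> topspace (tau_c U E E)" using openin_subset by fastforce
  qed
  have "ops U E E \<subseteq> tau_c U E E closure_of I E E"
  proof
    fix T assume T: "T \<in> ops U E E"
    obtain B where B: "B > 0" "\<And>x. x \<in> E \<Longrightarrow> norm (T x) \<le> B * norm x" using ops_bound[OF T] by blast
    show "T \<in> tau_c U E E closure_of I E E"
      unfolding in_closure_of top
    proof (intro conjI allI impI)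
      fix W assume W: "T \<in> W \<and> openin (tau_c U E E) W"
      obtain C e where C: "compact C" "C \<subseteq> E" "e > 0"
        "{S \<in> ops U E E. \<forall>x\<in>C. norm (S x - T x) < e} \<subseteq> W"
        using tau_c_basic_neighbourhood[OF E conjunct2[OF W] conjunct1[OF W] T] by blast
      obtain S where S: "S \<in> I E E" "\<forall>x\<in>C. norm (S x - x) < e / B"
        using id[rule_format, of C "e / B"] C(1-3) B(1) by auto
      have So: "S \<in> ops U E E" using S(1) ideal_subset_ops[OF I E E] by blast
      define R where "R = compose E T (compose E S (\<lambda>x\<in>E. x))"
      have R: "R \<in> I E E" unfolding R_def by (rule ideal_compose[OF I E E E E ops_id[OF E] S(1) T])
      have "norm (R x - T x) < e" if x: "x \<in> C" for x
      proof -
        have xE: "x \<in> E" using x C(2) by blast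
        have SxE: "S x \<in> E" by (rule ops_mem[OF So xE])
        have "norm (R x - T x) = norm (T (S x - x))"
          using ops_diff[OF T E SxE xE] xE by (simp add: R_def compose_eq)
        also have "\<dots> \<le> B * norm (S x - x)" by (rule B(2)[OF subspace_diff[OF real_subspace[OF E] SxE xE]])
        also have "\<dots> < B * (e / B)" using S(2) x B(1) by (intro mult_strict_left_mono) auto
        finally show ?thesis using B(1) by simp
      qed
      moreover have "R \<in> ops U E E" using R ideal_subset_ops[OF I E E] by blast
      ultimately have "R \<in> W" using C(4) by blast
      then show "\<exists>R. R \<in> I E E \<and> R \<in> W" using R by blast
    qed (rule T)
  qed
  moreover have "tau_c U E E closure_of I E E \<subseteq> ops U E E"
    using closure_of_subset_topspace[of "tau_c U E E" "I E E"] unfolding top .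
  ultimately show "approximation_property U I E"
    unfolding approximation_property_def by (rule equalityI)
qed

lemma approximation_property_null_sequence:
  assumes "operator_ideal U I" "E \<in> spaces U" "approximation_property U I E"
    and "range x \<subseteq> E" "x \<longlonglongrightarrow> 0" "e > 0"
  shows "\<exists>S\<in>I E E. \<forall>n. norm (S (x n) - x n) < e"
proof -
  have "compact (insert 0 (range x))" by (rule compact_insert_limit[OF assms(5)])
  moreover have "insert 0 (range x) \<subseteq> E" using assms(4) subspace_0[OF real_subspace[OF assms(2)]] by blast
  ultimately have "\<exists>S\<in>I E E. \<forall>z\<in>insert 0 (range x). norm (S z - z) < e"
    using assms(3,6) approximation_property_iff[OF assms(1,2)] by blast
  then show ?thesis by auto
qed

lemma approximation_property_from_dual:
  assumes I1: "operator_ideal U I1" and I2: "operator_ideal U I2"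
    and sub: "op_class_subset U I2 (dual_ideal U I1) \<or> op_class_subset U (dual_ideal U I2) I1"
    and E: "E \<in> spaces U" and refl: "reflexive U E"
    and ap: "approximation_property U I2 (dual U E)"
  shows "approximation_property U I1 E"
  unfolding approximation_property_iff[OF I1 E]
proof (intro allI impI)
  fix C and e :: real assume C: "compact C \<and> C \<subseteq> E \<and> e > 0"
  have E': "dual U E \<in> spaces U" and E'': "dual U (dual U E) \<in> spaces U" using E dual_in_spaces by auto
  let ?J = "bidual_embedding U E"
  note J = embedding_in_ops[OF E]
  obtain K where K: "K \<in> ops U (dual U (dual U E)) E" "\<And>x. x \<in> E \<Longrightarrow> K (?J x) = x"
    using reflexive_inverse[OF E refl] by blast
  define \<S> where "\<S> = {S \<in> ops U E E. adjoint_op U E E S \<in> I2 (dual U E) (dual U E)}"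
  have "\<exists>S\<in>\<S>. \<forall>x\<in>C. norm (S x - x) < e"
  proof (rule uniform_approximation[OF E])
    show "\<S> \<subseteq> ops U E E" by (auto simp: \<S>_def)
    show "(\<lambda>x\<in>E. S x + T x) \<in> \<S>" if "S \<in> \<S>" "T \<in> \<S>" for S T
      using that ops_sum[OF E _ _ E, of S T] ideal_add[OF I2 E' E'] adjoint_add[OF E E, of S T]
      by (simp add: \<S>_def)
    show "(\<lambda>x\<in>E. scal U (of_real r) (S x)) \<in> \<S>" if "S \<in> \<S>" for r S
      using that ops_scal_mult[OF E _ E, of S] ideal_scal[OF I2 E' E'] adjoint_scal[OF E E, of S]
      by (simp add: \<S>_def)
  next
    fix \<psi> :: "nat \<Rightarrow> 'v" and e :: real assume "range \<psi> \<subseteq> dual U E" "\<psi> \<longlonglongrightarrow> 0" "e > 0"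
    then obtain R where R: "R \<in> I2 (dual U E) (dual U E)" "\<forall>n. norm (R (\<psi> n) - \<psi> n) < e"
      using approximation_property_null_sequence[OF I2 E' ap] by blast
    then have "R \<in> ops U (dual U E) (dual U E)" using ideal_subset_ops[OF I2 E' E'] by blast
    then obtain S where "S \<in> ops U E E" "adjoint_op U E E S = R"
      using reflexive_adjoint_surj[OF E refl] by metis
    then show "\<exists>S\<in>\<S>. \<forall>n. norm (adjoint_op U E E S (\<psi> n) - \<psi> n) < e"
      using R by (intro bexI[of _ S]) (auto simp: \<S>_def)
  qed (use C in auto)
  moreover have "\<S> \<subseteq> I1 E E"
  proof
    fix S assume "S \<in> \<S>"
    then have S: "S \<in> ops U E E" and S': "adjoint_op U E E S \<in> I2 (dual U E) (dual U E)" by (auto simp: \<S>_def)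
    let ?S'' = "adjoint_op U (dual U E) (dual U E) (adjoint_op U E E S)"
    from sub show "S \<in> I1 E E"
    proof
      assume "op_class_subset U I2 (dual_ideal U I1)"
      then have "?S'' \<in> I1 (dual U (dual U E)) (dual U (dual U E))"
        using S' E' by (auto simp: op_class_subset_def dual_ideal_def)
      then have mem: "compose E K (compose E ?S'' ?J) \<in> I1 E E"
        by (intro ideal_compose[OF I1 E E'' E'' E J _ K(1)])
      have "compose E K (compose E ?S'' ?J) = S"
      proof (rule extensionalityI[OF _ ops_ext[OF S]])
        fix x assume x: "x \<in> E"
        then show "compose E K (compose E ?S'' ?J) x = S x"
          by (simp add: compose_eq biadjoint_embedding[OF E E S x] K(2) ops_mem[OF S x])
      qed (simp add: compose_def)
      with mem show ?thesis by simp
    next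
      assume "op_class_subset U (dual_ideal U I2) I1"
      moreover have "S \<in> dual_ideal U I2 E E" using S S' by (simp add: dual_ideal_def)
      ultimately show ?thesis using E unfolding op_class_subset_def by blast
    qed
  qed
  ultimately show "\<exists>S\<in>I1 E E. \<forall>x\<in>C. norm (S x - x) < e" by blast
qed

lemma approximation_property_dual:
  assumes I1: "operator_ideal U I1" and I2: "operator_ideal U I2"
    and sub: "op_class_subset U I2 (dual_ideal U I1) \<or> op_class_subset U (dual_ideal U I2) I1"
    and E: "E \<in> spaces U" and refl: "reflexive U E"
    and ap: "approximation_property U I2 E"
  shows "approximation_property U I1 (dual U E)"
proof -
  have E': "dual U E \<in> spaces U" and E'': "dual U (dual U E) \<in> spaces U" using E dual_in_spaces by auto
  let ?J = "bidual_embedding U E"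
  note J = embedding_in_ops[OF E]
  obtain K where K: "K \<in> ops U (dual U (dual U E)) E"
    "\<And>z. z \<in> dual U (dual U E) \<Longrightarrow> ?J (K z) = z"
    using reflexive_inverse[OF E refl] by blast
  define \<S> where "\<S> = adjoint_op U E E ` I2 E E"
  have I2o: "R \<in> ops U E E" if "R \<in> I2 E E" for R using that ideal_subset_ops[OF I2 E E] by blast
  have biadj: "adjoint_op U (dual U E) (dual U E) (adjoint_op U E E R) = 
      compose (dual U (dual U E)) ?J (compose (dual U (dual U E)) R K)" if R: "R \<in> ops U E E" for R
  proof (rule extensionalityI[OF ops_ext[OF adjoint_in_ops[OF E' E' adjoint_in_ops[OF E E R]]]])
    fix z assume z: "z \<in> dual U (dual U E)"
    show "adjoint_op U (dual U E) (dual U E) (adjoint_op U E E R) z =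
        compose (dual U (dual U E)) ?J (compose (dual U (dual U E)) R K) z"
      using biadjoint_embedding[OF E E R ops_mem[OF K(1) z]] z by (simp add: compose_eq K(2))
  qed (simp add: compose_def)
  show ?thesis
    unfolding approximation_property_iff[OF I1 E']
  proof (intro allI impI)
    fix C and e :: real assume C: "compact C \<and> C \<subseteq> dual U E \<and> e > 0"
    have "\<exists>S\<in>\<S>. \<forall>x\<in>C. norm (S x - x) < e"
    proof (rule uniform_approximation[OF E'])
      show "\<S> \<subseteq> ops U (dual U E) (dual U E)"
        unfolding \<S>_def by (intro image_subsetI adjoint_in_ops[OF E E] I2o)
    next
      fix S T assume "S \<in> \<S>" "T \<in> \<S>"
      then obtain P Q where P: "P \<in> I2 E E" "S = adjoint_op U E E P" and Q: "Q \<in> I2 E E" "T = adjoint_op U E E Q"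
        unfolding \<S>_def by blast
      note PQ = ideal_add[OF I2 E E P(1) Q(1)]
      have "(\<lambda>x\<in>dual U E. S x + T x) = adjoint_op U E E (\<lambda>x\<in>E. P x + Q x)"
        using adjoint_add[OF E E I2o[OF P(1)] I2o[OF Q(1)] I2o[OF PQ]] by (simp add: P(2) Q(2))
      then show "(\<lambda>x\<in>dual U E. S x + T x) \<in> \<S>" using PQ by (simp add: \<S>_def)
    next
      fix r S assume "S \<in> \<S>"
      then obtain P where P: "P \<in> I2 E E" "S = adjoint_op U E E P"
        unfolding \<S>_def by blast
      note cP = ideal_scal[OF I2 E E P(1), of "of_real r"]
      have "(\<lambda>x\<in>dual U E. scal U (of_real r) (S x)) = adjoint_op U E E (\<lambda>x\<in>E. scal U (of_real r) (P x))"
        using adjoint_scal[OF E E I2o[OF P(1)] I2o[OF cP]] by (simp add: P(2))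
      then show "(\<lambda>x\<in>dual U E. scal U (of_real r) (S x)) \<in> \<S>" using cP by (simp add: \<S>_def)
    next
      fix \<psi> :: "nat \<Rightarrow> 'v" and e :: real
      assume \<psi>: "range \<psi> \<subseteq> dual U (dual U E)" "\<psi> \<longlonglongrightarrow> 0" "e > 0"
      have \<psi>E: "\<psi> n \<in> dual U (dual U E)" for n using \<psi>(1) by blast
      obtain B where B: "B > 0" "\<And>z. z \<in> dual U (dual U E) \<Longrightarrow> norm (K z) \<le> B * norm z"
        using ops_bound[OF K(1)] by blast
      have KE: "K (\<psi> n) \<in> E" for n by (rule ops_mem[OF K(1) \<psi>E])
      have "(\<lambda>n. B * norm (\<psi> n)) \<longlonglongrightarrow> B * 0" by (intro tendsto_intros tendsto_norm_zero \<psi>(2))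
      then have "(\<lambda>n. B * norm (\<psi> n)) \<longlonglongrightarrow> 0" by simp
      moreover have "\<forall>\<^sub>F n in sequentially. norm (K (\<psi> n)) \<le> B * norm (\<psi> n)"
        using B(2)[OF \<psi>E] by simp
      ultimately have K0: "(\<lambda>n. K (\<psi> n)) \<longlonglongrightarrow> 0" by (rule Lim_null_comparison[rotated])
      have "range (\<lambda>n. K (\<psi> n)) \<subseteq> E" using KE by blast
      from approximation_property_null_sequence[OF I2 E ap this K0 \<psi>(3)]
      obtain R where R: "R \<in> I2 E E" "\<forall>n. norm (R (K (\<psi> n)) - K (\<psi> n)) < e" by blast
      have "norm (adjoint_op U (dual U E) (dual U E) (adjoint_op U E E R) (\<psi> n) - \<psi> n) < e" for n
      proof -
        have RK: "R (K (\<psi> n)) \<in> E" by (rule ops_mem[OF I2o[OF R(1)] KE])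
        have eq: "adjoint_op U (dual U E) (dual U E) (adjoint_op U E E R) (\<psi> n) - \<psi> n
            = ?J (R (K (\<psi> n)) - K (\<psi> n))"
          unfolding biadj[OF I2o[OF R(1)]] ops_diff[OF J E RK KE] K(2)[OF \<psi>E]
          by (simp add: compose_eq \<psi>E)
        have "norm (?J (R (K (\<psi> n)) - K (\<psi> n))) \<le> norm (R (K (\<psi> n)) - K (\<psi> n))"
          by (rule norm_embedding_le[OF E subspace_diff[OF real_subspace[OF E] RK KE]])
        then show ?thesis unfolding eq using R(2)[rule_format, of n] by simp
      qed
      then show "\<exists>S\<in>\<S>. \<forall>n. norm (adjoint_op U (dual U E) (dual U E) S (\<psi> n) - \<psi> n) < e"
        using R(1) unfolding \<S>_def by blast
    qed (use C in auto)
    moreover have "\<S> \<subseteq> I1 (dual U E) (dual U E)"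
    proof
      fix S assume "S \<in> \<S>"
      then obtain R where R: "R \<in> I2 E E" "S = adjoint_op U E E R"
        unfolding \<S>_def by blast
      from sub show "S \<in> I1 (dual U E) (dual U E)"
      proof
        assume "op_class_subset U I2 (dual_ideal U I1)"
        then have "R \<in> dual_ideal U I1 E E" using R(1) E unfolding op_class_subset_def by blast
        then show ?thesis by (simp add: dual_ideal_def R(2))
      next
        assume dI2: "op_class_subset U (dual_ideal U I2) I1"
        have "adjoint_op U (dual U E) (dual U E) S \<in> I2 (dual U (dual U E)) (dual U (dual U E))"
          unfolding R(2) biadj[OF I2o[OF R(1)]] by (rule ideal_compose[OF I2 E'' E E E'' K(1) R(1) J])
        then have "S \<in> dual_ideal U I2 (dual U E) (dual U E)"
          using adjoint_in_ops[OF E E I2o[OF R(1)]] by (simp add: dual_ideal_def R(2))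
        then show ?thesis using dI2 E' unfolding op_class_subset_def by blast
      qed
    qed
    ultimately show "\<exists>S\<in>I1 (dual U E) (dual U E). \<forall>x\<in>C. norm (S x - x) < e" by blast
  qed
qed

end

theorem theorem4p2:
  fixes U :: "('k::real_or_complex, 'v::real_normed_vector) universe"
    and I1 I2 :: "'v op_class"
    and E :: "'v set"
  assumes "banach_universe U"
    and "operator_ideal U I1"
    and "operator_ideal U I2"
    and "op_class_subset U I2 (dual_ideal U I1) \<or> op_class_subset U (dual_ideal U I2) I1"
    and "E \<in> spaces U"
    and "reflexive U E"
  shows "(approximation_property U I2 (dual U E) \<longrightarrow> approximation_property U I1 E) \<and>
         (approximation_property U I2 E \<longrightarrow> approximation_property U I1 (dual U E))"
proof -
  interpret banach_space_universe U by unfold_locales (rule assms(1))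
  show ?thesis
    using approximation_property_from_dual[OF assms(2-6)] approximation_property_dual[OF assms(2-6)] by blast
qed

end
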